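(* Let $\beta\in(0,2)$, set $\beta_*=\frac{1+\sqrt5}{2}$, and let $L_\beta$ be the operator generated by the power-type kernel $k_\beta(j)=|j|^{-(1+\beta)}$, $j\in\mathbb{Z}\setminus\{0\}$, $k_\beta(0)=0$. (a) If $\beta\in(0,\beta_*]$, then there exist constants $c_1,c_2,\nu>0$ such that $L_\beta$ satisfies $CD_\Upsilon(0,F)$ with a $CD$-function $F$ such that $F(x)\sim c_1x^{\frac{1+2\beta}{\beta}}$ as $x\to0$ and $F(x)\sim c_2e^{\nu x}$ as $x\to\infty$. (b) If $\beta\in(\beta_*,2)$, then for every $\varepsilon\in(0,\beta-1)$ (arbitrarily small) there exist constants $c_3,c_4,\nu>0$ such that $L_\beta$ satisfies $CD_\Upsilon(0,F)$ with a $CD$-function $F$ such that $F(x)\sim c_3x^{\frac{\beta-\varepsilon}{\beta-\varepsilon-1}}$ as $x\to0$ and $F(x)\sim c_4e^{\nu x}$ as $x\to\infty$.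
   Context: For a kernel $k:\mathbb{Z}\to[0,\infty)$ that is not identically zero, with $k(0)=0$, $k(j)=k(-j)$ and $\sum_{j}k(j)<\infty$, the operator generated by $k$ is $Lu(x)=\sum_{j\in\mathbb{Z}}k(j)\big(u(x+j)-u(x)\big)$, $x\in\mathbb{Z}$. $\ell^\infty(\mathbb{Z})$ denotes the bounded functions $\mathbb{Z}\to\mathbb{R}$. $f\sim g$ as $x\to x_0$ means $f(x)/g(x)\to1$ as $x\to x_0$. Let $\Upsilon(r)=e^r-1-r$, $r\in\mathbb{R}$. For $u,v\in\ell^\infty(\mathbb{Z})$ put $\Psi_\Upsilon(u)(x)=\sum_{y\in\mathbb{Z}}k(x-y)\Upsilon(u(y)-u(x))$, $B_{\Upsilon'}(u,v)(x)=\sum_{y\in\mathbb{Z}}k(x-y)\Upsilon'(u(y)-u(x))(v(y)-v(x))$ and $\Psi_{2,\Upsilon}(u)(x)=\frac12\big(L\Psi_\Upsilon(u)(x)-B_{\Upsilon'}(u,Lu)(x)\big)$. A $CD$-function is a continuous $F:[0,\infty)\to[0,\infty)$ with $F(0)=0$, $r\mapsto F(r)/r$ strictly increasing on $(0,\infty)$, and $1/F$ integrable at $\infty$. $L$ satisfies $CD_\Upsilon(0,F)$ if for every $u\in\ell^\infty(\mathbb{Z})$ and every $x\in\mathbb{Z}$: $\Psi_{2,\Upsilon}(u)(x)\ge F(-Lu(x))$ whenever $-Lu(x)\ge 0$ (and $\Psi_{2,\Upsilon}(u)(x)\ge 0$ otherwise). *)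

theory Defs
  imports "HOL-Analysis.Analysis" "HOL-Library.Landau_Symbols"
begin

definition admissible_kernel :: "(int \<Rightarrow> real) \<Rightarrow> bool" where
  "admissible_kernel k \<longleftrightarrow>
     (\<forall>j. 0 \<le> k j) \<and> (\<exists>j. k j \<noteq> 0) \<and> k 0 = 0 \<and> (\<forall>j. k j = k (- j)) \<and> k summable_on UNIV"

text \<open>
  The operators below take an arbitrary kernel. For an admissible kernel and bounded functions
  all the infinite sums converge absolutely, so that \<^const>\<open>infsum\<close> does not return its default
  value 0.
\<close>

definition gen_op :: "(int \<Rightarrow> real) \<Rightarrow> (int \<Rightarrow> real) \<Rightarrow> int \<Rightarrow> real" where
  "gen_op k u x = (\<Sum>\<^sub>\<infinity>j\<in>UNIV. k j * (u (x + j) - u x))"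

definition Upsilon :: "real \<Rightarrow> real" where
  "Upsilon r = exp r - 1 - r"

definition Psi :: "(real \<Rightarrow> real) \<Rightarrow> (int \<Rightarrow> real) \<Rightarrow> (int \<Rightarrow> real) \<Rightarrow> int \<Rightarrow> real" where
  "Psi H k u x = (\<Sum>\<^sub>\<infinity>y\<in>UNIV. k (x - y) * H (u y - u x))"

definition B_op ::
    "(real \<Rightarrow> real) \<Rightarrow> (int \<Rightarrow> real) \<Rightarrow> (int \<Rightarrow> real) \<Rightarrow> (int \<Rightarrow> real) \<Rightarrow> int \<Rightarrow> real" where
  "B_op H k u v x = (\<Sum>\<^sub>\<infinity>y\<in>UNIV. k (x - y) * H (u y - u x) * (v y - v x))"

definition Psi2_Upsilon :: "(int \<Rightarrow> real) \<Rightarrow> (int \<Rightarrow> real) \<Rightarrow> int \<Rightarrow> real" where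
  "Psi2_Upsilon k u x =
     (gen_op k (Psi Upsilon k u) x - B_op (deriv Upsilon) k u (gen_op k u) x) / 2"

text \<open>
  A function on \<open>[0,\<infinity>)\<close> is represented by a total function on the reals whose values on the
  negative half-line are irrelevant. Integrability at infinity means Lebesgue integrability on
  some half-line \<open>[R,\<infinity>)\<close> with \<open>R > 0\<close>.
\<close>

definition CD_function :: "(real \<Rightarrow> real) \<Rightarrow> bool" where
  "CD_function F \<longleftrightarrow>
     continuous_on {0..} F \<and> (\<forall>r\<ge>0. 0 \<le> F r) \<and> F 0 = 0 \<and>
     strict_mono_on {0<..} (\<lambda>r. F r / r) \<and>
     (\<exists>R>0. set_integrable lborel {R..} (\<lambda>r. 1 / F r))"

text \<open>The condition $CD_\Upsilon(0,F)$ for the operator generated by \<open>k\<close>.\<close>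

definition CD_Upsilon0 :: "(int \<Rightarrow> real) \<Rightarrow> (real \<Rightarrow> real) \<Rightarrow> bool" where
  "CD_Upsilon0 k F \<longleftrightarrow>
     (\<forall>u. bounded (range u) \<longrightarrow>
       (\<forall>x. if - gen_op k u x \<ge> 0 then Psi2_Upsilon k u x \<ge> F (- gen_op k u x)
            else Psi2_Upsilon k u x \<ge> 0))"

definition power_kernel :: "real \<Rightarrow> int \<Rightarrow> real" where
  "power_kernel \<beta> j = (if j = 0 then 0 else real_of_int \<bar>j\<bar> powr (- (1 + \<beta>)))"

lemma deriv_Upsilon: "deriv Upsilon r = exp r - 1"
proof -
  have "(Upsilon has_real_derivative exp r - 1) (at r)"
    unfolding Upsilon_def by (auto intro!: derivative_eq_intros)
  then show ?thesis by (rule DERIV_imp_deriv)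
qed

lemma admissible_power_kernel:
  assumes "0 < \<beta>"
  shows "admissible_kernel (power_kernel \<beta>)"
proof -
  let ?k = "power_kernel \<beta>"
  have nn: "0 \<le> ?k j" for j by (simp add: power_kernel_def)
  have sym: "?k j = ?k (- j)" for j by (simp add: power_kernel_def)
  have eq: "?k (int n) = real n powr (- (1 + \<beta>))" for n
    by (simp add: power_kernel_def)
  have "summable (\<lambda>n. real n powr (- (1 + \<beta>)))"
    using assms by (subst summable_real_powr_iff) auto
  then have nat: "(?k \<circ> int) summable_on UNIV"
    by (subst summable_on_UNIV_nonneg_real_iff) (auto simp: nn eq o_def)
  then have pos: "?k summable_on range int"
    by (subst summable_on_reindex) (auto simp: inj_on_def)
  have "(?k \<circ> (\<lambda>n. - int n)) summable_on UNIV"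
    using nat by (simp add: o_def sym[symmetric])
  then have neg: "?k summable_on range (\<lambda>n. - int n)"
    by (subst summable_on_reindex) (auto simp: inj_on_def)
  have "(UNIV :: int set) = range int \<union> range (\<lambda>n. - int n)"
    by (auto intro: int_cases2)
  with summable_on_union[OF pos neg] have "?k summable_on UNIV" by simp
  moreover have "?k 1 \<noteq> 0" "?k 0 = 0" by (simp_all add: power_kernel_def)
  ultimately show ?thesis unfolding admissible_kernel_def using nn sym by blast
qed

end

theory Submission
  imports Defs
begin

text \<open>
  Fix \<open>u\<close> and \<open>x\<close>, write \<open>c j = u (x + j) - u x\<close>, \<open>w\<^sub>n = - (c n + c (- n))\<close>, and let \<open>s = - L u x\<close>, which
  is the sum of \<open>k n * w\<^sub>n\<close> over \<open>n \<ge> 1\<close>. Expanding the definitions and exchanging the two jumps in some of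
  the terms yields
  \[ 2 \Psi_{2,\Upsilon}(u)(x) = \sum_{j,l} k(j) k(l) e^{c(j)} \Upsilon(c(j+l) - c(j) - c(l)) \]
  (\<open>Psi2_Upsilon_double_sum\<close>). All terms are nonnegative, so the task is to bound \<open>s\<close> from above by a part
  of this double sum, the energy \<open>E\<close>.

  The antipodal terms \<open>l = - j\<close> contribute at least \<open>(k n)\<^sup>2 * pair_cost w\<^sub>n\<close>, where the cost is quadratic
  for small and exponential for large \<open>w\<^sub>n\<close>. Young's inequality up to a cutoff \<open>N\<close>, and a variant of it
  that exploits the fast growth of the cost beyond \<open>N\<close>, give
  \<open>s \<le> C * (E * N powr (1 + \<beta>) + N powr - \<beta>)\<close> (\<open>cutoff_bound_antipodal\<close>). Choosing \<open>N\<close> of order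
  \<open>s powr (- 1 / \<beta>)\<close> leads to \<open>E \<ge> \<kappa> * s powr ((1 + 2 * \<beta>) / \<beta>)\<close> for bounded \<open>s\<close>, which is what the first
  part asks for.

  For \<open>\<beta>\<close> close to \<open>2\<close> this misses the nearly local behaviour of the operator. There the terms \<open>(1, i)\<close>
  help: their weight \<open>k i\<close> is far larger than the antipodal weight \<open>(k i)\<^sup>2\<close>, and they say that \<open>c\<close> is
  nearly additive along unit steps, so that \<open>w\<^sub>n\<close> is a sum of small errors. Below the cutoff this replaces
  \<open>N powr (1 + \<beta>)\<close> by \<open>N\<^sup>2\<close>; beyond it the antipodal terms are kept, which costs a little in the other
  exponent: \<open>s \<le> C * (E * N\<^sup>2 + N powr - b)\<close> with \<open>2 * (\<beta> - 1) \<le> b < \<beta>\<close> (\<open>cutoff_bound_chain\<close>). Optimising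
  \<open>N\<close> yields the exponent \<open>1 + 2 / b\<close>, which is at most \<open>\<beta> / (\<beta> - 1)\<close> and hence below the exponent
  \<open>(\<beta> - \<epsilon>) / (\<beta> - \<epsilon> - 1)\<close> of the second part.

  If \<open>s\<close> is large, some \<open>w\<^sub>n\<close> is at least of order \<open>s * n powr (\<beta> / 2)\<close>, and the corresponding antipodal
  pair alone makes \<open>E\<close> exponentially large (\<open>energy_ge_exponential\<close>). A power near \<open>0\<close> glued to an
  exponential and multiplied by a small constant is then a CD-function below both bounds
  (\<open>ex_CD_function\<close>).
\<close>

section \<open>Elementary inequalities for \<open>\<Upsilon>\<close>\<close>

lemma Upsilon_nonneg: "0 \<le> Upsilon r"
  using exp_ge_add_one_self[of r] by (simp add: Upsilon_def del: exp_ge_add_one_self)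

text \<open>
  The tangent with slope \<open>\<tau>\<close> lies below the convex function \<open>\<Upsilon>\<close>. Its exact intercept is minus the
  convex conjugate \<open>(1 + \<tau>) * ln (1 + \<tau>) - \<tau>\<close>, which is at most \<open>\<tau>\<^sup>2\<close>.
\<close>

lemma Upsilon_tangent:
  assumes "-1 \<le> \<tau>"
  shows "\<tau> * e - \<tau>\<^sup>2 \<le> Upsilon e"
proof -
  have "(1 + \<tau>) * (1 + (e - \<tau>)) \<le> exp \<tau> * exp (e - \<tau>)"
  proof (cases "1 + (e - \<tau>) \<ge> 0")
    case True
    then show ?thesis
      using assms by (intro mult_mono) (auto intro: exp_ge_add_one_self)
  next
    case False
    then have "(1 + \<tau>) * (1 + (e - \<tau>)) \<le> 0"
      using assms by (intro mult_nonneg_nonpos) auto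
    then show ?thesis by (smt (verit) exp_gt_zero mult_pos_pos)
  qed
  also have "exp \<tau> * exp (e - \<tau>) = exp e"
    by (simp flip: exp_add)
  finally show ?thesis
    by (simp add: Upsilon_def algebra_simps power2_eq_square)
qed

lemma Upsilon_young_abs:
  assumes "0 \<le> t" "t \<le> 1"
  shows "t * \<bar>e\<bar> \<le> Upsilon e + t\<^sup>2"
  using Upsilon_tangent[of t e] Upsilon_tangent[of "-t" e] assms by (auto simp: abs_if)

text \<open>
  For small \<open>w\<close> the quadratic Taylor polynomial dominates, for large \<open>w\<close> the exponential. The rate
  \<open>3/4\<close> may be any number in \<open>(1/2, 1)\<close>: it has to stay above \<open>1/2\<close> in order to beat the factor
  \<open>exp (- w / 2)\<close> that multiplies \<open>\<Upsilon>\<close> in \<open>pair_cost\<close> below.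
\<close>

lemma Upsilon_lower_bound:
  assumes "0 \<le> w"
  shows "w\<^sup>2 * exp (3 * w / 4) / 64 \<le> Upsilon w"
proof (cases "w \<le> 3")
  case True
  have "exp (3 * w / 4) \<le> exp (1 + 1 + 1)" using True by simp
  also have "\<dots> = exp 1 * exp 1 * exp (1::real)" by (simp only: exp_add)
  also have "\<dots> \<le> 3 * 3 * 3" by (intro mult_mono exp_le) auto
  finally have "w\<^sup>2 * exp (3 * w / 4) \<le> w\<^sup>2 * 32"
    by (intro mult_left_mono) auto
  moreover have "1 + w + w\<^sup>2 / 2 \<le> exp w"
    using assms exp_lower_Taylor_quadratic by blast
  ultimately show ?thesis by (simp add: Upsilon_def)
next
  case False
  have "1 + w / 4 + (w / 4)\<^sup>2 / 2 \<le> exp (w / 4)"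
    using assms by (intro exp_lower_Taylor_quadratic) auto
  then have "w\<^sup>2 / 32 \<le> exp (w / 4)"
    using assms by (simp add: power2_eq_square)
  then have "w\<^sup>2 / 32 * exp (3 * w / 4) \<le> exp (w / 4) * exp (3 * w / 4)"
    by (intro mult_right_mono) auto
  also have "\<dots> = exp w" by (simp flip: exp_add)
  finally have a: "w\<^sup>2 * exp (3 * w / 4) / 64 \<le> exp w / 2" by simp
  have "1 + w + w\<^sup>2 / 2 \<le> exp w"
    using assms exp_lower_Taylor_quadratic by blast
  moreover have "3 * w \<le> w\<^sup>2" using False by (simp add: power2_eq_square)
  ultimately have "exp w / 2 \<ge> 1 + w" using False by argo
  with a show ?thesis by (simp add: Upsilon_def)
qed

lemma powr_le_exp_quarter:
  fixes w r :: real
  assumes "0 \<le> w" "0 < r"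
  shows "w powr r \<le> (4 * r) powr r * exp (w / 4)"
proof -
  have "w / (4 * r) \<le> exp (w / (4 * r))"
    using exp_ge_add_one_self[of "w / (4 * r)"] by linarith
  then have "w \<le> (4 * r) * exp (w / (4 * r))"
    using assms by (simp add: field_simps)
  then have "w powr r \<le> ((4 * r) * exp (w / (4 * r))) powr r"
    using assms by (intro powr_mono2) auto
  also have "\<dots> = (4 * r) powr r * exp (w / 4)"
    using assms by (subst powr_mult) (auto simp: exp_powr_real)
  finally show ?thesis .
qed

text \<open>
  The two antipodal terms \<open>(j, -j)\<close> and \<open>(-j, j)\<close> of the double sum for
  \<open>2 \<Psi>\<^sub>2\<close> carry the weights \<open>exp (c j)\<close> and \<open>exp (c (- j))\<close>. With \<open>w = - (c j + c (- j))\<close> their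
  sum is at least \<open>exp (- w / 2)\<close>, so together they cost at least \<open>pair_cost w\<close>. The cost is quadratic
  near \<open>0\<close> and grows exponentially as \<open>w\<close> tends to infinity.
\<close>

definition pair_cost :: "real \<Rightarrow> real" where
  "pair_cost w = exp (- w / 2) * Upsilon w"

lemma pair_cost_nonneg: "0 \<le> pair_cost w"
  by (simp add: pair_cost_def Upsilon_nonneg)

lemma pair_cost_lower_bound:
  assumes "0 \<le> w"
  shows "w\<^sup>2 * exp (w / 4) / 64 \<le> pair_cost w"
proof -
  have "w\<^sup>2 * exp (w / 4) / 64 = exp (- w / 2) * (w\<^sup>2 * exp (3 * w / 4) / 64)"
    by (simp flip: exp_add)
  also have "\<dots> \<le> pair_cost w"
    unfolding pair_cost_def using assms by (intro mult_left_mono Upsilon_lower_bound) auto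
  finally show ?thesis .
qed

text \<open>
  A Young inequality: since the cost dominates \<open>w powr (1 + 1 / \<delta>)\<close> for \<open>w \<ge> 0\<close>, either
  \<open>w \<le> t powr \<delta>\<close>, or \<open>t < w powr (1 / \<delta>)\<close> and \<open>w * t\<close> is controlled by the cost. Small \<open>\<delta>\<close> exploits the
  fast growth of the cost.
\<close>

lemma pair_cost_young:
  assumes "0 < \<delta>" "\<delta> \<le> 1"
  obtains C where "0 < C" "\<And>w t. 0 \<le> t \<Longrightarrow> w * t \<le> C * pair_cost w + t powr (1 + \<delta>)"
proof -
  define r where "r = 1 / \<delta> - 1"
  have r: "0 \<le> r" using assms by (simp add: r_def)
  define K where "K = 1 + (4 * r) powr r"
  have K: "1 \<le> K" by (simp add: K_def)
  have wr: "w powr r \<le> K * exp (w / 4)" if "0 \<le> w" for w :: real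
  proof (cases "r = 0")
    case True
    have "w powr r \<le> 1" using True by (simp add: powr_def)
    also have "\<dots> \<le> K * exp (w / 4)"
      using mult_mono[OF K, of 1 "exp (w / 4)"] that K by auto
    finally show ?thesis .
  next
    case False
    then have "w powr r \<le> (4 * r) powr r * exp (w / 4)"
      using r that by (intro powr_le_exp_quarter) auto
    also have "\<dots> \<le> K * exp (w / 4)"
      by (intro mult_right_mono) (auto simp: K_def)
    finally show ?thesis .
  qed
  have main: "w * t \<le> 64 * K * pair_cost w + t powr (1 + \<delta>)" if t: "0 \<le> t" for w t
  proof -
    have cost: "0 \<le> 64 * K * pair_cost w"
      using pair_cost_nonneg[of w] K by auto
    consider "t = 0 \<or> w \<le> 0" | "0 < t" "0 < w" "w \<le> t powr \<delta>" | "0 < t" "0 < w" "t powr \<delta> < w"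
      using t by fastforce
    then show ?thesis
    proof cases
      case 1
      then have "w * t \<le> 0" using t by (auto simp: mult_nonpos_nonneg)
      then show ?thesis using cost powr_ge_zero[of t "1 + \<delta>"] by linarith
    next
      case 2
      then have "w * t \<le> t powr \<delta> * t" by (intro mult_right_mono) auto
      also have "\<dots> = t powr (1 + \<delta>)" using 2 by (simp add: powr_add)
      finally show ?thesis using cost by linarith
    next
      case 3
      have "t = (t powr \<delta>) powr (1 / \<delta>)"
        using assms 3 by (simp add: powr_powr)
      also have "\<dots> \<le> w powr (1 / \<delta>)"
        using assms 3 by (intro powr_mono2) auto
      also have "\<dots> = w powr (1 + r)" by (simp add: r_def)
      also have "\<dots> = w * w powr r" using 3 by (simp add: powr_add)
      finally have "w * t \<le> w\<^sup>2 * w powr r"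
        using 3 by (simp add: power2_eq_square)
      also have "\<dots> \<le> w\<^sup>2 * (K * exp (w / 4))"
        using wr 3 by (intro mult_left_mono) auto
      also have "\<dots> = 64 * K * (w\<^sup>2 * exp (w / 4) / 64)" by simp
      also have "\<dots> \<le> 64 * K * pair_cost w"
        using pair_cost_lower_bound[of w] K 3 by (intro mult_left_mono) auto
      finally show ?thesis using powr_ge_zero[of t "1 + \<delta>"] by linarith
    qed
  qed
  show ?thesis using that[of "64 * K"] main K by auto
qed

section \<open>Sums of powers\<close>

lemma powr_decrement_ge:
  fixes q :: real
  assumes "1 < q" "1 \<le> n"
  shows "real (Suc n) powr - q \<le> (real n powr (1 - q) - real (Suc n) powr (1 - q)) / (q - 1)"
proof -
  have "\<exists>z. real n < z \<and> z < real (Suc n) \<and>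
      real (Suc n) powr (1 - q) - real n powr (1 - q) =
      (real (Suc n) - real n) * ((1 - q) * z powr (1 - q - 1))"
    using assms by (intro MVT2) (auto intro!: derivative_eq_intros)
  then obtain z where z: "real n < z" "z < real (Suc n)"
    and eq: "real (Suc n) powr (1 - q) - real n powr (1 - q) = (1 - q) * z powr (- q)"
    by (auto simp: diff_diff_eq2)
  have "real (Suc n) powr - q \<le> z powr - q"
    using z assms by (intro powr_mono2') auto
  also have "\<dots> = (real n powr (1 - q) - real (Suc n) powr (1 - q)) / (q - 1)"
    using eq assms by (simp add: field_simps)
  finally show ?thesis .
qed

lemma sum_powr_tail_le:
  fixes q :: real
  assumes "1 < q" "1 \<le> N"
  shows "(\<Sum>n\<in>{N<..M}. real n powr - q) \<le> real N powr (1 - q) / (q - 1)"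
proof -
  have "(\<Sum>n\<in>{N<..M}. real n powr - q) \<le> (real N powr (1 - q) - real M powr (1 - q)) / (q - 1)"
    if "N \<le> M"
    using that
  proof (induction M rule: dec_induct)
    case (step n)
    have "{N<..Suc n} = insert (Suc n) {N<..n}" using step by auto
    then show ?case
      using step powr_decrement_ge[of q n] assms by (auto simp: diff_divide_distrib)
  qed auto
  moreover have "(real N powr (1 - q) - real M powr (1 - q)) / (q - 1) \<le> real N powr (1 - q) / (q - 1)"
    using assms by (intro divide_right_mono) auto
  ultimately show ?thesis
    using assms by (cases "N \<le> M") auto
qed

lemma sum_powr_head_le:
  fixes r :: real
  assumes "0 < r" "r \<le> 1"
  shows "(\<Sum>n\<in>{1..N}. real n powr (r - 1)) \<le> real N powr r / r"
proof (induction N)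
  case (Suc N)
  have "real (Suc N) powr (r - 1) \<le> (real (Suc N) powr r - real N powr r) / r"
  proof (cases "N = 0")
    case True
    then show ?thesis using assms by simp
  next
    case False
    have "\<exists>z. real N < z \<and> z < real (Suc N) \<and>
        real (Suc N) powr r - real N powr r = (real (Suc N) - real N) * (r * z powr (r - 1))"
      using False by (intro MVT2) (auto intro!: derivative_eq_intros)
    then obtain z where z: "real N < z" "z < real (Suc N)"
      and eq: "real (Suc N) powr r - real N powr r = r * z powr (r - 1)"
      by auto
    have "real (Suc N) powr (r - 1) \<le> z powr (r - 1)"
      using z assms by (intro powr_mono2') auto
    then show ?thesis using eq assms by simp
  qed
  then show ?case using Suc by (simp add: diff_divide_distrib)
qed simp

section \<open>The double sum for the second-order operator\<close>

lemma has_sum_diff_real: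
  fixes f g :: "'a \<Rightarrow> real"
  assumes "(f has_sum a) A" "(g has_sum b) A"
  shows "((\<lambda>x. f x - g x) has_sum a - b) A"
  using has_sum_add[OF assms(1), of "\<lambda>x. - g x" "- b"] assms(2) by (simp add: has_sum_uminus)

lemma infsum_diff_real:
  fixes f g :: "'a \<Rightarrow> real"
  assumes "f summable_on A" "g summable_on A"
  shows "infsum f A - infsum g A = (\<Sum>\<^sub>\<infinity>x\<in>A. f x - g x)"
  using has_sum_diff_real[OF has_sum_infsum[OF assms(1)] has_sum_infsum[OF assms(2)]]
  by (simp add: infsumI)

text \<open>
  Turns the sums over \<open>y\<close> in \<open>\<Psi>\<^sub>\<Upsilon>\<close> and in \<open>B\<close> into sums over jumps, as in the generator.
\<close>

lemma kernel_sum_shift: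
  assumes "admissible_kernel k"
  shows "(\<Sum>\<^sub>\<infinity>y\<in>UNIV. k (z - y) * h y) = (\<Sum>\<^sub>\<infinity>l\<in>UNIV. k l * h (z + l))"
proof -
  have sym: "k (- l) = k l" for l
    using assms unfolding admissible_kernel_def by metis
  have "bij_betw (\<lambda>l. z + l) UNIV (UNIV :: int set)"
    by (rule bij_betwI[where g = "\<lambda>y. y - z"]) auto
  from infsum_reindex_bij_betw[OF this, of "\<lambda>y. k (z - y) * h y"] show ?thesis
    by (simp add: sym)
qed

lemma kernel_mult_bounded_summable:
  assumes "admissible_kernel k" and b: "\<And>j. \<bar>b j\<bar> \<le> B"
  shows "(\<lambda>j. k j * b j) summable_on UNIV"
proof -
  have k: "0 \<le> k j" "k summable_on UNIV" for j
    using assms by (auto simp: admissible_kernel_def)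
  have "(\<lambda>j. k j * B) summable_on UNIV"
    using k by (intro summable_on_cmult_left)
  then have "(\<lambda>j. norm (k j * b j)) summable_on UNIV"
    using k b by (intro Infinite_Sum.abs_summable_on_comparison_test') (auto simp: abs_mult intro!: mult_left_mono)
  then show ?thesis by (rule abs_summable_summable)
qed

lemma kernel_square_mult_bounded_summable:
  assumes "admissible_kernel k" and b: "\<And>j l. \<bar>b j l\<bar> \<le> B"
  shows "(\<lambda>(j, l). k j * k l * b j l) summable_on UNIV \<times> UNIV"
proof -
  have k: "0 \<le> k j" "k summable_on UNIV" for j
    using assms by (auto simp: admissible_kernel_def)
  have "(\<lambda>(j, l). k j * k l) summable_on UNIV \<times> UNIV"
  proof (rule summable_on_SigmaI)
    show "((\<lambda>l. case (j, l) of (j, l) \<Rightarrow> k j * k l) has_sum k j * infsum k UNIV) UNIV" for j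
      using k by (auto intro!: has_sum_cmult_right)
    show "(\<lambda>j. k j * infsum k UNIV) summable_on UNIV"
      using k by (intro summable_on_cmult_left)
  qed (use k in auto)
  then have "(\<lambda>p. (case p of (j, l) \<Rightarrow> k j * k l) * B) summable_on UNIV \<times> UNIV"
    by (rule summable_on_cmult_left)
  then have "(\<lambda>p. norm (case p of (j, l) \<Rightarrow> k j * k l * b j l)) summable_on UNIV \<times> UNIV"
    by (rule Infinite_Sum.abs_summable_on_comparison_test')
       (use k b in \<open>auto simp: abs_mult intro!: mult_left_mono mult_nonneg_nonneg\<close>)
  then show ?thesis by (rule abs_summable_summable)
qed

definition increment :: "(int \<Rightarrow> real) \<Rightarrow> int \<Rightarrow> int \<Rightarrow> real" where
  "increment u x j = u (x + j) - u x"

text \<open>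
  With \<open>d = c (j + l)\<close> the summand of \<open>L \<Psi>\<^sub>\<Upsilon> - B\<close> simplifies to
  \<open>exp (d - c j) - exp (c l) - exp (c j) * (d - c j - c l)\<close>. The weight \<open>k j * k l\<close> is symmetric, so the
  roles of \<open>j\<close> and \<open>l\<close> may be exchanged in the first two terms, which leaves
  \<open>exp (c j) * \<Upsilon> (d - c j - c l)\<close>. In particular \<open>\<Psi>\<^sub>2\<close> is nonnegative, and any part of the double sum
  bounds it from below.
\<close>

lemma Psi2_Upsilon_double_sum:
  fixes x :: int
  assumes k: "admissible_kernel k" and u: "bounded (range u)"
  defines "c \<equiv> increment u x"
  shows "((\<lambda>(j, l). k j * k l * (exp (c j) * Upsilon (c (j + l) - c j - c l)))
    has_sum 2 * Psi2_Upsilon k u x) (UNIV \<times> UNIV)"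
proof -
  obtain M where M: "\<And>y. \<bar>u y\<bar> \<le> M"
    using u by (auto simp: bounded_iff)
  have M0: "0 \<le> M" using M[of 0] by linarith
  have c: "\<bar>c j\<bar> \<le> 2 * M" for j
    using M[of "x + j"] M[of x] unfolding c_def increment_def by linarith
  have cd: "\<bar>c i - c j\<bar> \<le> 4 * M" for i j
    using c[of i] c[of j] by linarith
  have e: "\<bar>exp r\<bar> \<le> exp R" if "\<bar>r\<bar> \<le> R" for r R :: real
    using that by auto
  have Ub: "\<bar>Upsilon r\<bar> \<le> exp R + R" if "\<bar>r\<bar> \<le> R" for r R
    using that Upsilon_nonneg[of r] e[OF that] unfolding Upsilon_def by linarith
  let ?f = "\<lambda>j l. Upsilon (c (j + l) - c j) - Upsilon (c l)"
  let ?g = "\<lambda>j l. (exp (c j) - 1) * (c (j + l) - c j - c l)"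
  have Uc: "\<bar>Upsilon (c (j + l) - c j)\<bar> \<le> exp (4 * M) + 4 * M" for j l
    by (rule Ub[OF cd])
  have Uc': "\<bar>Upsilon (c l)\<bar> \<le> exp (2 * M) + 2 * M" for l
    by (rule Ub[OF c])
  have fB: "\<bar>?f j l\<bar> \<le> exp (4 * M) + 4 * M + (exp (2 * M) + 2 * M)" for j l
    using Uc[of j l] Uc'[of l] by linarith
  have D: "\<bar>c (j + l) - c j - c l\<bar> \<le> 6 * M" for j l
    using cd[of "j + l" j] c[of l] by linarith
  have E1: "\<bar>exp (c j)\<bar> \<le> exp (2 * M)" for j by (rule e[OF c])
  have gB: "\<bar>?g j l\<bar> \<le> (exp (2 * M) + 1) * (6 * M)" for j l
  proof -
    have "\<bar>exp (c j) - 1\<bar> \<le> exp (2 * M) + 1" using E1[of j] by linarith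
    then show ?thesis
      unfolding abs_mult using D[of j l] M0 by (intro mult_mono) auto
  qed
  have Psi: "Psi Upsilon k u (x + j) = (\<Sum>\<^sub>\<infinity>l\<in>UNIV. k l * Upsilon (c (j + l) - c j))" for j
    unfolding Psi_def using kernel_sum_shift[OF k, of "x + j" "\<lambda>y. Upsilon (u y - u (x + j))"]
    by (simp add: c_def increment_def add.assoc)
  have Psi0: "Psi Upsilon k u x = (\<Sum>\<^sub>\<infinity>l\<in>UNIV. k l * Upsilon (c l))"
    using Psi[of 0] by (simp add: c_def increment_def)
  have s1: "(\<lambda>l. k l * Upsilon (c (j + l) - c j)) summable_on UNIV" for j
    by (rule kernel_mult_bounded_summable[OF k Uc])
  have s0: "(\<lambda>l. k l * Upsilon (c l)) summable_on UNIV"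
    by (rule kernel_mult_bounded_summable[OF k Uc'])
  have "gen_op k (Psi Upsilon k u) x =
      (\<Sum>\<^sub>\<infinity>j\<in>UNIV. k j * ((\<Sum>\<^sub>\<infinity>l\<in>UNIV. k l * Upsilon (c (j + l) - c j)) - (\<Sum>\<^sub>\<infinity>l\<in>UNIV. k l * Upsilon (c l))))"
    unfolding gen_op_def Psi Psi0 ..
  also have "\<dots> = (\<Sum>\<^sub>\<infinity>j\<in>UNIV. \<Sum>\<^sub>\<infinity>l\<in>UNIV. k j * k l * ?f j l)"
    using s1 s0
    by (simp add: infsum_diff_real infsum_cmult_right'[symmetric] algebra_simps)
  also have "\<dots> = (\<Sum>\<^sub>\<infinity>(j, l)\<in>UNIV \<times> UNIV. k j * k l * ?f j l)"
    by (rule infsum_Sigma'_banach, rule kernel_square_mult_bounded_summable[where b = ?f, OF k fB])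
  finally have LPsi: "gen_op k (Psi Upsilon k u) x =
    (\<Sum>\<^sub>\<infinity>(j, l)\<in>UNIV \<times> UNIV. k j * k l * ?f j l)" .
  have L: "gen_op k u (x + j) = (\<Sum>\<^sub>\<infinity>l\<in>UNIV. k l * (c (j + l) - c j))" for j
    by (simp add: gen_op_def c_def increment_def add.assoc)
  have L0: "gen_op k u x = (\<Sum>\<^sub>\<infinity>l\<in>UNIV. k l * c l)"
    by (simp add: gen_op_def c_def increment_def)
  have s2: "(\<lambda>l. k l * (c (j + l) - c j)) summable_on UNIV" for j
    by (rule kernel_mult_bounded_summable[OF k cd])
  have s3: "(\<lambda>l. k l * c l) summable_on UNIV"
    by (rule kernel_mult_bounded_summable[OF k c])
  have "B_op (deriv Upsilon) k u (gen_op k u) x =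
      (\<Sum>\<^sub>\<infinity>j\<in>UNIV. k j * ((exp (c j) - 1) * (gen_op k u (x + j) - gen_op k u x)))"
    using kernel_sum_shift[OF k, of x "\<lambda>y. (exp (u y - u x) - 1) * (gen_op k u y - gen_op k u x)"]
    by (simp add: B_op_def deriv_Upsilon c_def increment_def mult.assoc)
  also have "\<dots> = (\<Sum>\<^sub>\<infinity>j\<in>UNIV. \<Sum>\<^sub>\<infinity>l\<in>UNIV. k j * k l * ?g j l)"
    unfolding L L0 using s2 s3
    by (simp add: infsum_diff_real infsum_cmult_right'[symmetric] algebra_simps)
  also have "\<dots> = (\<Sum>\<^sub>\<infinity>(j, l)\<in>UNIV \<times> UNIV. k j * k l * ?g j l)"
    by (rule infsum_Sigma'_banach, rule kernel_square_mult_bounded_summable[where b = ?g, OF k gB])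
  finally have Bop: "B_op (deriv Upsilon) k u (gen_op k u) x =
    (\<Sum>\<^sub>\<infinity>(j, l)\<in>UNIV \<times> UNIV. k j * k l * ?g j l)" .
  \<comment> \<open>The combined summand splits into three bounded pieces, each summable against the kernel;
      in the first two the indices are swapped separately.\<close>
  let ?S = "\<lambda>h. \<Sum>\<^sub>\<infinity>(j, l)\<in>UNIV \<times> UNIV. k j * k l * h j l"
  have swap: "?S h = ?S (\<lambda>j l. h l j)" for h :: "int \<Rightarrow> int \<Rightarrow> real"
    using infsum_reindex_bij_betw[OF bij_swap, of "\<lambda>(j, l). k j * k l * h j l"]
    by (simp add: case_prod_unfold mult.commute)
  define a where "a j l = exp (c (j + l) - c j)" for j l
  define b where "b j l = exp (c j)" for j l :: int
  define d where "d j l = exp (c j) * (c (j + l) - c j - c l)" for j l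
  have aB: "\<bar>a j l\<bar> \<le> exp (4 * M)" for j l unfolding a_def by (rule e[OF cd])
  have bB: "\<bar>b j l\<bar> \<le> exp (2 * M)" for j l unfolding b_def by (rule E1)
  have dB: "\<bar>d j l\<bar> \<le> exp (2 * M) * (6 * M)" for j l
    unfolding d_def abs_mult using D[of j l] E1[of j] by (intro mult_mono) auto
  note sm = kernel_square_mult_bounded_summable[OF k]
  have hs: "((\<lambda>(j, l). k j * k l * h j l) has_sum ?S h) (UNIV \<times> UNIV)"
    if "\<And>j l. \<bar>h j l\<bar> \<le> B" for h :: "int \<Rightarrow> int \<Rightarrow> real" and B
    using sm[OF that] by simp
  have aB': "\<bar>a l j\<bar> \<le> exp (4 * M)" and bB': "\<bar>b l j\<bar> \<le> exp (2 * M)" for j l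
    using aB bB by blast+
  have dbl: "gen_op k (Psi Upsilon k u) x - B_op (deriv Upsilon) k u (gen_op k u) x =
      2 * Psi2_Upsilon k u x"
    by (simp add: Psi2_Upsilon_def)
  have 1: "((\<lambda>(j, l). k j * k l * ?f j l - k j * k l * ?g j l) has_sum
      2 * Psi2_Upsilon k u x) (UNIV \<times> UNIV)"
    using has_sum_diff_real[OF hs[where h = ?f, OF fB] hs[where h = ?g, OF gB]]
    unfolding LPsi[symmetric] Bop[symmetric] dbl by (simp add: case_prod_unfold)
  have 2: "?f j l - ?g j l = a j l - b l j - d j l" for j l
    by (simp add: a_def b_def d_def Upsilon_def algebra_simps)
  have 3: "((\<lambda>(j, l). k j * k l * a j l - k j * k l * b l j - k j * k l * d j l) has_sum
      2 * Psi2_Upsilon k u x) (UNIV \<times> UNIV)"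
    using 1 by (simp only: right_diff_distrib[symmetric] 2)
  have "((\<lambda>(j, l). k j * k l * a j l - k j * k l * b l j - k j * k l * d j l) has_sum
      ?S a - ?S (\<lambda>j l. b l j) - ?S d) (UNIV \<times> UNIV)"
    using has_sum_diff_real[OF has_sum_diff_real[OF hs[where h = a, OF aB] hs[where h = "\<lambda>j l. b l j", OF bB']] hs[where h = d, OF dB]]
    by (simp add: case_prod_unfold)
  with 3 have val: "2 * Psi2_Upsilon k u x = ?S a - ?S (\<lambda>j l. b l j) - ?S d"
    by (rule has_sum_unique)
  have "((\<lambda>(j, l). k j * k l * a l j - k j * k l * b j l - k j * k l * d j l) has_sum
      ?S (\<lambda>j l. a l j) - ?S b - ?S d) (UNIV \<times> UNIV)"
    using has_sum_diff_real[OF has_sum_diff_real[OF hs[where h = "\<lambda>j l. a l j", OF aB'] hs[where h = b, OF bB]] hs[where h = d, OF dB]]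
    by (simp add: case_prod_unfold)
  also have "?S (\<lambda>j l. a l j) - ?S b - ?S d = 2 * Psi2_Upsilon k u x"
    unfolding val using swap[of a] swap[of b] by simp
  also have "(\<lambda>(j, l). k j * k l * a l j - k j * k l * b j l - k j * k l * d j l) =
      (\<lambda>(j, l). k j * k l * (exp (c j) * Upsilon (c (j + l) - c j - c l)))"
  proof -
    have "a l j - b j l - d j l = exp (c j) * Upsilon (c (j + l) - c j - c l)" for j l
    proof -
      have "exp (c j) * exp (c (j + l) - c j - c l) = exp (c (j + l) - c l)"
        by (simp flip: exp_add)
      then show ?thesis
        by (simp add: a_def b_def d_def Upsilon_def algebra_simps)
    qed
    then show ?thesis by (simp add: right_diff_distrib[symmetric])
  qed
  finally show ?thesis .
qed

section \<open>Lower bounds by parts of the double sum\<close>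

definition energy_term :: "(int \<Rightarrow> real) \<Rightarrow> (int \<Rightarrow> real) \<Rightarrow> int \<times> int \<Rightarrow> real" where
  "energy_term k c = (\<lambda>(j, l). k j * k l * (exp (c j) * Upsilon (c (j + l) - c j - c l)))"

text \<open>
  All later estimates use finitely many terms of the double sum at a time. For
  \<open>c = increment u x\<close> the least such \<open>E\<close> is \<open>2 * Psi2_Upsilon k u x\<close>.
\<close>

definition energy_bound :: "(int \<Rightarrow> real) \<Rightarrow> (int \<Rightarrow> real) \<Rightarrow> real \<Rightarrow> bool" where
  "energy_bound k c E \<longleftrightarrow> (\<forall>A. finite A \<longrightarrow> (\<Sum>p\<in>A. energy_term k c p) \<le> E)"

definition neg_second_difference :: "(int \<Rightarrow> real) \<Rightarrow> nat \<Rightarrow> real" where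
  "neg_second_difference c n = - (c (int n) + c (- int n))"

text \<open>
  Over \<open>I = {1..M}\<close> these are the symmetric partial sums of the series for \<open>- L u x\<close>.
\<close>

abbreviation antipodal_sum :: "real \<Rightarrow> (int \<Rightarrow> real) \<Rightarrow> nat set \<Rightarrow> real" where
  "antipodal_sum \<beta> c I \<equiv> \<Sum>n\<in>I. real n powr - (1 + \<beta>) * neg_second_difference c n"

text \<open>
  The common form of the two estimates behind the theorem: jumps up to \<open>N\<close> are paid for by the energy
  \<open>E\<close>, jumps beyond \<open>N\<close> have little mass under the kernel. Optimising \<open>N\<close> yields
  \<open>E \<ge> \<kappa> * s powr (1 + a / b)\<close> for \<open>s = - L u x\<close> in a bounded range.
\<close>

definition cutoff_bound :: "real \<Rightarrow> real \<Rightarrow> real \<Rightarrow> bool" where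
  "cutoff_bound \<beta> a b \<longleftrightarrow> (\<exists>C>0. \<forall>c E N M. energy_bound (power_kernel \<beta>) c E \<longrightarrow> c 0 = 0 \<longrightarrow> 1 \<le> N \<longrightarrow>
    antipodal_sum \<beta> c {1..M} \<le> C * (E * real N powr a + real N powr - b))"

lemma energy_bound_Psi2_Upsilon:
  assumes k: "admissible_kernel k" and u: "bounded (range u)"
  shows "energy_bound k (increment u x) (2 * Psi2_Upsilon k u x)"
  unfolding energy_bound_def
proof (intro allI impI)
  fix A :: "(int \<times> int) set"
  assume A: "finite A"
  have "0 \<le> k j" for j using k by (simp add: admissible_kernel_def)
  then have nn: "0 \<le> energy_term k (increment u x) p" for p
    by (cases p) (simp add: energy_term_def Upsilon_nonneg)
  have "(energy_term k (increment u x) has_sum 2 * Psi2_Upsilon k u x) (UNIV \<times> UNIV)"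
    using Psi2_Upsilon_double_sum[OF k u] by (simp add: energy_term_def)
  then show "sum (energy_term k (increment u x)) A \<le> 2 * Psi2_Upsilon k u x"
    by (rule finite_sum_le_has_sum) (use A nn in auto)
qed

lemma energy_bound_nonneg: "energy_bound k c E \<Longrightarrow> 0 \<le> E"
  unfolding energy_bound_def by (drule spec[of _ "{}"]) simp

lemma energy_bound_two_families:
  assumes "energy_bound k c E" "finite I" "inj_on f I" "inj_on g I" "f ` I \<inter> g ` I = {}"
  shows "(\<Sum>n\<in>I. energy_term k c (f n) + energy_term k c (g n)) \<le> E"
proof -
  have "(\<Sum>n\<in>I. energy_term k c (f n) + energy_term k c (g n)) =
      sum (energy_term k c) (f ` I) + sum (energy_term k c) (g ` I)"
    using assms by (simp add: sum.distrib sum.reindex)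
  also have "\<dots> = sum (energy_term k c) (f ` I \<union> g ` I)"
    using assms by (subst sum.union_disjoint) auto
  also have "\<dots> \<le> E"
    by (rule assms(1)[unfolded energy_bound_def, rule_format]) (use assms(2) in simp)
  finally show ?thesis .
qed

lemma energy_bound_reflect:
  assumes E: "energy_bound k c E" and sym: "\<And>j. k (- j) = k j"
  shows "energy_bound k (\<lambda>j. c (- j)) E"
  unfolding energy_bound_def
proof (intro allI impI)
  fix A :: "(int \<times> int) set"
  assume A: "finite A"
  let ?r = "\<lambda>p. (- fst p, - snd p) :: int \<times> int"
  have "(\<Sum>p\<in>A. energy_term k (\<lambda>j. c (- j)) p) = (\<Sum>p\<in>A. energy_term k c (?r p))"
    by (simp add: energy_term_def case_prod_unfold sym)
  also have "\<dots> = sum (energy_term k c) (?r ` A)"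
    by (subst sum.reindex) (auto simp: inj_on_def prod_eq_iff)
  also have "\<dots> \<le> E"
    by (rule E[unfolded energy_bound_def, rule_format]) (use A in simp)
  finally show "(\<Sum>p\<in>A. energy_term k (\<lambda>j. c (- j)) p) \<le> E" .
qed

lemma power_kernel_of_nat: "power_kernel \<beta> (int n) = real n powr - (1 + \<beta>)"
  by (simp add: power_kernel_def)

lemma power_kernel_uminus: "power_kernel \<beta> (- j) = power_kernel \<beta> j"
  by (simp add: power_kernel_def)

lemma exp_midpoint_le: "exp ((a + b) / 2) \<le> exp a + exp (b::real)"
proof (cases "a \<le> b")
  case True
  then have "exp ((a + b) / 2) \<le> exp b" by simp
  then show ?thesis using exp_gt_zero[of a] by linarith
next
  case False
  then have "exp ((a + b) / 2) \<le> exp a" by simp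
  then show ?thesis using exp_gt_zero[of b] by linarith
qed

text \<open>
  The terms \<open>(n, -n)\<close> and \<open>(-n, n)\<close> involve \<open>c (n - n) = c 0 = 0\<close>, so they only see the second
  difference \<open>w\<^sub>n = - (c n + c (- n))\<close>.
\<close>

lemma sum_antipodal_le:
  assumes E: "energy_bound (power_kernel \<beta>) c E" and c0: "c 0 = 0"
    and I: "finite I" "I \<subseteq> {1..}"
  shows "(\<Sum>n\<in>I. (real n powr - (1 + \<beta>))\<^sup>2 * pair_cost (neg_second_difference c n)) \<le> E"
proof -
  let ?k = "power_kernel \<beta>"
  have "(\<Sum>n\<in>I. (real n powr - (1 + \<beta>))\<^sup>2 * pair_cost (neg_second_difference c n)) \<le>
      (\<Sum>n\<in>I. energy_term ?k c (int n, - int n) + energy_term ?k c (- int n, int n))"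
  proof (rule sum_mono)
    fix n assume "n \<in> I"
    let ?w = "neg_second_difference c n"
    have "pair_cost ?w \<le> (exp (c (int n)) + exp (c (- int n))) * Upsilon ?w"
      unfolding pair_cost_def
      using exp_midpoint_le[of "c (int n)" "c (- int n)"]
      by (intro mult_right_mono) (auto simp: neg_second_difference_def Upsilon_nonneg add.commute)
    then have "(real n powr - (1 + \<beta>))\<^sup>2 * pair_cost ?w \<le>
        (real n powr - (1 + \<beta>))\<^sup>2 * ((exp (c (int n)) + exp (c (- int n))) * Upsilon ?w)"
      by (intro mult_left_mono) auto
    also have "\<dots> = energy_term ?k c (int n, - int n) + energy_term ?k c (- int n, int n)"
      by (simp add: energy_term_def power_kernel_uminus power_kernel_of_nat c0
          neg_second_difference_def power2_eq_square algebra_simps)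
    finally show "(real n powr - (1 + \<beta>))\<^sup>2 * pair_cost ?w \<le>
        energy_term ?k c (int n, - int n) + energy_term ?k c (- int n, int n)" .
  qed
  also have "\<dots> \<le> E"
    using I by (intro energy_bound_two_families[OF E]) (auto simp: inj_on_def)
  finally show ?thesis .
qed

lemma antipodal_le:
  assumes "energy_bound (power_kernel \<beta>) c E" "c 0 = 0" "1 \<le> n"
  shows "(real n powr - (1 + \<beta>))\<^sup>2 * pair_cost (neg_second_difference c n) \<le> E"
  using sum_antipodal_le[OF assms(1,2), of "{n}"] assms(3) by simp

text \<open>
  The Young inequality for \<open>pair_cost\<close> with \<open>t = \<mu> / k n\<close>, multiplied by \<open>(k n)\<^sup>2 / \<mu>\<close> to pass
  from the weights \<open>(k n)\<^sup>2\<close> of the energy to the weights \<open>k n\<close> of the generator.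
\<close>

lemma weighted_sum_le:
  assumes "0 < \<delta>" "\<delta> \<le> 1"
  shows "\<exists>C>0. \<forall>\<beta> c E \<mu> I. energy_bound (power_kernel \<beta>) c E \<longrightarrow> c 0 = 0 \<longrightarrow> 0 < \<mu> \<longrightarrow> finite I \<longrightarrow> I \<subseteq> {1..} \<longrightarrow>
      antipodal_sum \<beta> c I \<le>
        C * (E / \<mu>) + \<mu> powr \<delta> * (\<Sum>n\<in>I. real n powr - ((1 + \<beta>) * (1 - \<delta>)))"
proof -
  obtain C where C: "0 < C"
    "\<And>w t. 0 \<le> t \<Longrightarrow> w * t \<le> C * pair_cost w + t powr (1 + \<delta>)"
    using pair_cost_young[OF assms] by blast
  have "antipodal_sum \<beta> c I \<le>
      C * (E / \<mu>) + \<mu> powr \<delta> * (\<Sum>n\<in>I. real n powr - ((1 + \<beta>) * (1 - \<delta>)))"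
    if E: "energy_bound (power_kernel \<beta>) c E" and c0: "c 0 = 0" and \<mu>: "0 < \<mu>"
      and I: "finite I" "I \<subseteq> {1..}" for \<beta> c E \<mu> I
  proof -
    let ?k = "\<lambda>n. real n powr - (1 + \<beta>)" and ?w = "neg_second_difference c"
    have "?k n * ?w n \<le> C / \<mu> * ((?k n)\<^sup>2 * pair_cost (?w n)) +
        \<mu> powr \<delta> * real n powr - ((1 + \<beta>) * (1 - \<delta>))" if "n \<in> I" for n
    proof -
      have kpos: "0 < ?k n" using that I by auto
      have "?k n * ?w n = (?k n)\<^sup>2 / \<mu> * (?w n * (\<mu> / ?k n))"
        using kpos \<mu> by (simp add: field_simps power2_eq_square)
      also have "\<dots> \<le> (?k n)\<^sup>2 / \<mu> * (C * pair_cost (?w n) + (\<mu> / ?k n) powr (1 + \<delta>))"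
        using kpos \<mu> by (intro mult_left_mono C(2)) auto
      also have "(\<mu> / ?k n) powr (1 + \<delta>) = \<mu> powr \<delta> * \<mu> * (?k n powr (1 - \<delta>) / (?k n)\<^sup>2)"
      proof -
        have "(\<mu> / ?k n) powr (1 + \<delta>) = \<mu> powr (1 + \<delta>) / ?k n powr (1 + \<delta>)"
          using \<mu> by (simp add: powr_divide)
        also have "\<mu> powr (1 + \<delta>) = \<mu> powr \<delta> * \<mu>"
          using \<mu> by (simp add: powr_add)
        also have "?k n powr (1 - \<delta>) / (?k n)\<^sup>2 = 1 / ?k n powr (1 + \<delta>)"
        proof -
          have "?k n powr (1 - \<delta>) * ?k n powr (1 + \<delta>) = (?k n)\<^sup>2"
            using kpos by (simp del: powr_powr flip: powr_add)
          then show ?thesis using kpos by (simp add: field_simps del: powr_powr)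
        qed
        then have "1 / ?k n powr (1 + \<delta>) = ?k n powr (1 - \<delta>) / (?k n)\<^sup>2" ..
        ultimately show ?thesis by (simp add: divide_inverse del: powr_powr)
      qed
      also have "?k n powr (1 - \<delta>) = real n powr - ((1 + \<beta>) * (1 - \<delta>))"
        by (simp add: powr_powr flip: mult_minus_left)
      finally show ?thesis using kpos \<mu> by (simp add: field_simps)
    qed
    then have "(\<Sum>n\<in>I. ?k n * ?w n) \<le> (\<Sum>n\<in>I. C / \<mu> * ((?k n)\<^sup>2 * pair_cost (?w n)) +
        \<mu> powr \<delta> * real n powr - ((1 + \<beta>) * (1 - \<delta>)))"
      by (rule sum_mono)
    also have "\<dots> = C / \<mu> * (\<Sum>n\<in>I. (?k n)\<^sup>2 * pair_cost (?w n)) +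
        \<mu> powr \<delta> * (\<Sum>n\<in>I. real n powr - ((1 + \<beta>) * (1 - \<delta>)))"
      by (simp add: sum.distrib sum_distrib_left)
    also have "\<dots> \<le> C / \<mu> * E + \<mu> powr \<delta> * (\<Sum>n\<in>I. real n powr - ((1 + \<beta>) * (1 - \<delta>)))"
      using C(1) \<mu> sum_antipodal_le[OF E c0 I] by (intro add_right_mono mult_left_mono) auto
    finally show ?thesis by simp
  qed
  with C(1) show ?thesis by blast
qed

lemma sum_split_at:
  fixes f :: "nat \<Rightarrow> real"
  shows "(\<Sum>n\<in>{1..M}. f n) = (\<Sum>n\<in>{1..min N M}. f n) + (\<Sum>n\<in>{N<..M}. f n)"
proof -
  have "{1..M} = {1..min N M} \<union> {N<..M}" by auto
  then show ?thesis by (simp add: sum.union_disjoint disjoint_iff)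
qed

text \<open>
  Only the antipodal terms are used, with \<open>\<mu> = k N\<close>. Up to \<open>N\<close> the quadratic behaviour of the
  cost (\<open>\<delta> = 1\<close>) gives the error \<open>N * k N = N powr - \<beta>\<close>. Beyond \<open>N\<close> a small \<open>\<delta>\<close> makes the
  series of \<open>(k n) powr (1 - \<delta>)\<close> converge, and its tail times \<open>\<mu> powr \<delta>\<close> has the same order.
\<close>

lemma cutoff_bound_antipodal:
  assumes \<beta>: "0 < \<beta>"
  shows "cutoff_bound \<beta> (1 + \<beta>) \<beta>"
proof -
  \<comment> \<open>With this choice \<open>(k n) powr (1 - \<delta>)\<close> equals \<open>n powr - (1 + \<beta> / 2)\<close>, halfway between \<open>k n\<close> and
      the borderline of summability.\<close>
  define \<delta> where "\<delta> = \<beta> / (2 * (1 + \<beta>))"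
  have \<delta>: "0 < \<delta>" "\<delta> \<le> 1" and q: "(1 + \<beta>) * (1 - \<delta>) = 1 + \<beta> / 2" and \<delta>': "(1 + \<beta>) * \<delta> = \<beta> / 2"
    using \<beta> by (auto simp: \<delta>_def field_simps)
  obtain C1 where C1: "0 < C1"
    "\<forall>\<beta> c E \<mu> I. energy_bound (power_kernel \<beta>) c E \<longrightarrow> c 0 = 0 \<longrightarrow> 0 < \<mu> \<longrightarrow> finite I \<longrightarrow> I \<subseteq> {1..} \<longrightarrow>
      antipodal_sum \<beta> c I \<le>
        C1 * (E / \<mu>) + \<mu> powr 1 * (\<Sum>n\<in>I. real n powr - ((1 + \<beta>) * (1 - 1)))"
    using weighted_sum_le[OF zero_less_one order_refl] by blast
  obtain C2 where C2: "0 < C2"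
    "\<forall>\<beta> c E \<mu> I. energy_bound (power_kernel \<beta>) c E \<longrightarrow> c 0 = 0 \<longrightarrow> 0 < \<mu> \<longrightarrow> finite I \<longrightarrow> I \<subseteq> {1..} \<longrightarrow>
      antipodal_sum \<beta> c I \<le>
        C2 * (E / \<mu>) + \<mu> powr \<delta> * (\<Sum>n\<in>I. real n powr - ((1 + \<beta>) * (1 - \<delta>)))"
    using weighted_sum_le[OF \<delta>] by blast
  define C where "C = C1 + C2 + 1 + 2 / \<beta>"
  have Cpos: "0 < C" using C1 C2 \<beta> by (simp add: C_def add_pos_pos)
  have "antipodal_sum \<beta> c {1..M} \<le>
      C * (E * real N powr (1 + \<beta>) + real N powr - \<beta>)"
    if E: "energy_bound (power_kernel \<beta>) c E" and c0: "c 0 = 0" and N: "1 \<le> N" for c E N M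
  proof -
    let ?f = "\<lambda>n. real n powr - (1 + \<beta>) * neg_second_difference c n"
    define \<mu> where "\<mu> = real N powr - (1 + \<beta>)"
    have \<mu>: "0 < \<mu>" using N by (simp add: \<mu>_def)
    have E\<mu>: "E / \<mu> = E * real N powr (1 + \<beta>)"
      unfolding \<mu>_def powr_minus by (simp add: divide_inverse)
    have E0: "0 \<le> E * real N powr (1 + \<beta>)"
      using energy_bound_nonneg[OF E] by simp
    have "(\<Sum>n\<in>{1..min N M}. ?f n) \<le> C1 * (E / \<mu>) + \<mu> powr 1 * (\<Sum>n\<in>{1..min N M}. real n powr - ((1 + \<beta>) * (1 - 1)))"
      by (rule C1(2)[rule_format, OF E c0 \<mu>]) auto
    also have "(\<Sum>n\<in>{1..min N M}. real n powr - ((1 + \<beta>) * (1 - 1))) \<le> real N"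
      by simp
    then have "\<mu> powr 1 * (\<Sum>n\<in>{1..min N M}. real n powr - ((1 + \<beta>) * (1 - 1))) \<le> \<mu> * real N"
      using \<mu> by (simp add: mult_left_mono)
    also have "\<mu> * real N = real N powr (- (1 + \<beta>) + 1)"
      using N unfolding \<mu>_def powr_add by simp
    finally have head: "(\<Sum>n\<in>{1..min N M}. ?f n) \<le> C1 * (E * real N powr (1 + \<beta>)) + real N powr - \<beta>"
      by (simp add: E\<mu>)
    have "(\<Sum>n\<in>{N<..M}. ?f n) \<le> C2 * (E / \<mu>) + \<mu> powr \<delta> * (\<Sum>n\<in>{N<..M}. real n powr - ((1 + \<beta>) * (1 - \<delta>)))"
      by (rule C2(2)[rule_format, OF E c0 \<mu>]) auto
    also have "\<mu> powr \<delta> * (\<Sum>n\<in>{N<..M}. real n powr - ((1 + \<beta>) * (1 - \<delta>))) \<le>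
        \<mu> powr \<delta> * (real N powr (1 - (1 + \<beta>) * (1 - \<delta>)) / ((1 + \<beta>) * (1 - \<delta>) - 1))"
      using N \<beta> q by (intro mult_left_mono sum_powr_tail_le) auto
    also have "\<dots> = 2 / \<beta> * real N powr - \<beta>"
    proof -
      have "\<mu> powr \<delta> = real N powr - (\<beta> / 2)"
        unfolding \<mu>_def powr_powr mult_minus_left \<delta>' ..
      then show ?thesis unfolding q by (simp flip: powr_add)
    qed
    finally have tail: "(\<Sum>n\<in>{N<..M}. ?f n) \<le> C2 * (E * real N powr (1 + \<beta>)) + 2 / \<beta> * real N powr - \<beta>"
      by (simp add: E\<mu>)
    have "(\<Sum>n\<in>{1..M}. ?f n) \<le> (C1 + C2) * (E * real N powr (1 + \<beta>)) + (1 + 2 / \<beta>) * real N powr - \<beta>"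
      unfolding sum_split_at[of _ M N] using head tail by (simp add: algebra_simps)
    also have "\<dots> \<le> C * (E * real N powr (1 + \<beta>)) + C * real N powr - \<beta>"
      using C1 C2 \<beta> E0 by (intro add_mono mult_right_mono) (auto simp: C_def)
    finally show ?thesis by (simp add: algebra_simps)
  qed
  with Cpos show ?thesis unfolding cutoff_bound_def by blast
qed

section \<open>Chains of unit steps\<close>

text \<open>
  The argument of \<open>\<Upsilon>\<close> in the terms \<open>(1, i)\<close> of the double sum: the failure of \<open>c\<close> to increase by
  \<open>c 1\<close> between \<open>i\<close> and \<open>i + 1\<close>.
\<close>

definition chain_error :: "(int \<Rightarrow> real) \<Rightarrow> int \<Rightarrow> real" where
  "chain_error c i = c (1 + i) - c 1 - c i"

text \<open>
  Walking from \<open>0\<close> to \<open>n\<close> and to \<open>- n\<close> in unit steps, the contributions \<open>\<plusminus> n * c 1\<close> cancel and only the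
  errors remain. The positive walk stops at the error of index \<open>n - 1\<close> and the negative one at \<open>- n\<close>;
  subtracting the error at \<open>n\<close> keeps track of this shift in the induction.
\<close>

lemma neg_second_difference_le_chain_errors:
  assumes c0: "c 0 = 0"
  shows "neg_second_difference c n \<le>
    (\<Sum>i\<in>{1..n}. \<bar>chain_error c (int i)\<bar> + \<bar>chain_error c (- int i)\<bar>) - \<bar>chain_error c (int n)\<bar>"
proof (induction n)
  case 0
  then show ?case by (simp add: neg_second_difference_def chain_error_def c0)
next
  case (Suc n)
  have "neg_second_difference c (Suc n) =
      neg_second_difference c n + chain_error c (- int (Suc n)) - chain_error c (int n)"
    by (simp add: neg_second_difference_def chain_error_def)
  also have "\<dots> \<le> (\<Sum>i\<in>{1..n}. \<bar>chain_error c (int i)\<bar> + \<bar>chain_error c (- int i)\<bar>)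
      + \<bar>chain_error c (- int (Suc n))\<bar>"
    using Suc by linarith
  also have "\<dots> = (\<Sum>i\<in>{1..Suc n}. \<bar>chain_error c (int i)\<bar> + \<bar>chain_error c (- int i)\<bar>)
      - \<bar>chain_error c (int (Suc n))\<bar>"
    by simp
  finally show ?case .
qed

text \<open>
  The weight of the terms \<open>(1, i)\<close> is \<open>k 1 * k i = k i\<close>, which decays much more slowly than the weight \<open>(k i)\<^sup>2\<close>
  of the antipodal terms. The factor \<open>exp (c 1)\<close> is harmless as soon as \<open>c 1\<close> is bounded below.
\<close>

lemma sum_chain_le:
  assumes E: "energy_bound (power_kernel \<beta>) c E" and c1: "- 1 / 2 \<le> c 1"
  shows "(\<Sum>i\<in>{1..N}. real i powr - (1 + \<beta>) *
      (Upsilon (chain_error c (int i)) + Upsilon (chain_error c (- int i)))) \<le> exp (1 / 2) * E"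
proof -
  let ?k = "power_kernel \<beta>"
  let ?T = "\<lambda>i. energy_term ?k c (1, int i) + energy_term ?k c (1, - int i)"
  have "real i powr - (1 + \<beta>) * (Upsilon (chain_error c (int i)) + Upsilon (chain_error c (- int i)))
      \<le> exp (1 / 2) * ?T i" for i
  proof -
    let ?S = "real i powr - (1 + \<beta>) * (Upsilon (chain_error c (int i)) + Upsilon (chain_error c (- int i)))"
    have k1: "?k 1 = 1" by (simp add: power_kernel_def)
    have T: "?T i = exp (c 1) * ?S"
      by (simp add: energy_term_def k1 power_kernel_uminus power_kernel_of_nat chain_error_def algebra_simps)
    have "1 \<le> exp (1 / 2) * exp (c 1)"
      using c1 by (simp flip: exp_add)
    then have "1 * ?S \<le> (exp (1 / 2) * exp (c 1)) * ?S"
      by (intro mult_right_mono) (auto intro!: mult_nonneg_nonneg add_nonneg_nonneg Upsilon_nonneg)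
    then show ?thesis by (simp add: T mult.assoc)
  qed
  then have "(\<Sum>i\<in>{1..N}. real i powr - (1 + \<beta>) *
      (Upsilon (chain_error c (int i)) + Upsilon (chain_error c (- int i)))) \<le> (\<Sum>i\<in>{1..N}. exp (1 / 2) * ?T i)"
    by (rule sum_mono)
  also have "\<dots> = exp (1 / 2) * (\<Sum>i\<in>{1..N}. ?T i)"
    by (simp add: sum_distrib_left)
  also have "\<dots> \<le> exp (1 / 2) * E"
    by (intro mult_left_mono energy_bound_two_families[OF E]) (auto simp: inj_on_def)
  finally show ?thesis .
qed

lemma sum_powr_from_le:
  assumes "0 < \<beta>" "1 \<le> i"
  shows "(\<Sum>n\<in>{i..L}. real n powr - (1 + \<beta>)) \<le> (1 + 1 / \<beta>) * real i powr - \<beta>"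
proof -
  have "(\<Sum>n\<in>{i..L}. real n powr - (1 + \<beta>)) \<le> real i powr - (1 + \<beta>) + (\<Sum>n\<in>{i<..L}. real n powr - (1 + \<beta>))"
  proof (cases "i \<le> L")
    case True
    then have "{i..L} = insert i {i<..L}" by auto
    then show ?thesis by simp
  qed (simp add: sum_nonneg)
  also have "(\<Sum>n\<in>{i<..L}. real n powr - (1 + \<beta>)) \<le> real i powr (1 - (1 + \<beta>)) / (1 + \<beta> - 1)"
    using assms by (intro sum_powr_tail_le) auto
  also have "real i powr - (1 + \<beta>) \<le> real i powr - \<beta>"
    using assms by (intro powr_mono) auto
  finally show ?thesis using assms by (simp add: algebra_simps)
qed

lemma sum_triangle_swap:
  fixes f g :: "nat \<Rightarrow> real"
  shows "(\<Sum>n\<in>{1..L}. f n * (\<Sum>i\<in>{1..n}. g i)) = (\<Sum>i\<in>{1..L}. g i * (\<Sum>n\<in>{i..L}. f n))"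
proof -
  have "(\<Sum>n\<in>{1..L}. f n * (\<Sum>i\<in>{1..n}. g i)) = (\<Sum>n\<in>{1..L}. \<Sum>i | i \<in> {1..L} \<and> i \<le> n. f n * g i)"
    by (intro sum.cong refl) (auto simp: sum_distrib_left intro!: sum.cong)
  also have "\<dots> = (\<Sum>i\<in>{1..L}. \<Sum>n | n \<in> {1..L} \<and> i \<le> n. f n * g i)"
    by (rule sum.swap_restrict) auto
  also have "\<dots> = (\<Sum>i\<in>{1..L}. g i * (\<Sum>n\<in>{i..L}. f n))"
    by (intro sum.cong refl) (auto simp: sum_distrib_left mult.commute intro!: sum.cong)
  finally show ?thesis .
qed

text \<open>
  Exchanging the order of summation, the error at \<open>i\<close> enters with the weight
  \<open>\<Sum>n\<ge>i. k n\<close>, of order \<open>i powr - \<beta> = i * k i\<close>. Young's inequality for \<open>\<Upsilon>\<close> with slope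
  \<open>t = i / (2 * N\<^sup>2)\<close> turns it into the energy weight \<open>k i\<close> times \<open>N\<^sup>2\<close>, at the expense of the error
  \<open>i powr (1 - \<beta>) / N\<^sup>2\<close>, which sums up to \<open>N powr - \<beta>\<close> because \<open>\<beta> < 2\<close>.
\<close>

lemma head_sum_le_chain:
  assumes \<beta>: "1 < \<beta>" "\<beta> < 2" and E: "energy_bound (power_kernel \<beta>) c E" and c0: "c 0 = 0"
    and c1: "- 1 / 2 \<le> c 1" and N: "1 \<le> N" "L \<le> N"
  defines "\<kappa> \<equiv> 1 + 1 / \<beta>"
  shows "antipodal_sum \<beta> c {1..L} \<le>
    2 * \<kappa> * exp (1 / 2) * (E * (real N)\<^sup>2) + \<kappa> / (2 - \<beta>) * real N powr - \<beta>"
proof -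
  let ?k = "\<lambda>n. real n powr - (1 + \<beta>)"
  let ?p = "\<lambda>i. chain_error c (int i)" and ?m = "\<lambda>i. chain_error c (- int i)"
  let ?U = "\<lambda>i. Upsilon (?p i) + Upsilon (?m i)"
  have \<kappa>: "0 < \<kappa>" using \<beta> by (simp add: \<kappa>_def add_pos_pos)
  have NN: "0 < (real N)\<^sup>2" using N by simp
  have "(\<Sum>n\<in>{1..L}. ?k n * neg_second_difference c n) \<le> (\<Sum>n\<in>{1..L}. ?k n * (\<Sum>i\<in>{1..n}. \<bar>?p i\<bar> + \<bar>?m i\<bar>))"
  proof (intro sum_mono mult_left_mono)
    show "neg_second_difference c n \<le> (\<Sum>i\<in>{1..n}. \<bar>?p i\<bar> + \<bar>?m i\<bar>)" for n
      using neg_second_difference_le_chain_errors[of c n, OF c0] by linarith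
  qed simp
  also have "\<dots> = (\<Sum>i\<in>{1..L}. (\<bar>?p i\<bar> + \<bar>?m i\<bar>) * (\<Sum>n\<in>{i..L}. ?k n))"
    by (rule sum_triangle_swap)
  also have "\<dots> \<le> (\<Sum>i\<in>{1..L}. 2 * \<kappa> * (real N)\<^sup>2 * (?k i * ?U i) + \<kappa> / (real N)\<^sup>2 * real i powr (2 - \<beta> - 1))"
  proof (rule sum_mono)
    fix i assume i: "i \<in> {1..L}"
    define t where "t = real i / (2 * (real N)\<^sup>2)"
    have "real i * 1 \<le> real N * real N" using i N by (intro mult_mono) auto
    then have t: "0 \<le> t" "t \<le> 1"
      using NN by (auto simp: t_def power2_eq_square)
    have "(\<bar>?p i\<bar> + \<bar>?m i\<bar>) * (\<Sum>n\<in>{i..L}. ?k n) \<le> (\<bar>?p i\<bar> + \<bar>?m i\<bar>) * (\<kappa> * real i powr - \<beta>)"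
      unfolding \<kappa>_def using \<beta> i by (intro mult_left_mono sum_powr_from_le) auto
    also have "\<dots> = 2 * \<kappa> * (real N)\<^sup>2 * ?k i * (t * \<bar>?p i\<bar> + t * \<bar>?m i\<bar>)"
    proof -
      have "real i powr - \<beta> = ?k i * real i"
        using i powr_add[of "real i" "- (1 + \<beta>)" 1] by simp
      also have "\<dots> = 2 * (real N)\<^sup>2 * ?k i * t"
        using NN N by (simp add: t_def)
      finally show ?thesis by (simp add: algebra_simps)
    qed
    also have "\<dots> \<le> 2 * \<kappa> * (real N)\<^sup>2 * ?k i * (?U i + 2 * t\<^sup>2)"
      using \<kappa> Upsilon_young_abs[OF t, of "?p i"] Upsilon_young_abs[OF t, of "?m i"]
      by (intro mult_left_mono) auto
    also have "\<dots> = 2 * \<kappa> * (real N)\<^sup>2 * (?k i * ?U i) + \<kappa> / (real N)\<^sup>2 * real i powr (2 - \<beta> - 1)"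
    proof -
      have "real i powr (2 - \<beta> - 1) = real i powr (- (1 + \<beta>) + 2)" by simp
      also have "\<dots> = ?k i * (real i)\<^sup>2"
        unfolding powr_add using i by simp
      finally have "\<kappa> / (real N)\<^sup>2 * real i powr (2 - \<beta> - 1) = 2 * \<kappa> * (real N)\<^sup>2 * ?k i * (2 * t\<^sup>2)"
        using NN N by (simp add: t_def power_divide power_mult_distrib field_simps)
      then show ?thesis by (simp add: algebra_simps)
    qed
    finally show "(\<bar>?p i\<bar> + \<bar>?m i\<bar>) * (\<Sum>n\<in>{i..L}. ?k n) \<le>
        2 * \<kappa> * (real N)\<^sup>2 * (?k i * ?U i) + \<kappa> / (real N)\<^sup>2 * real i powr (2 - \<beta> - 1)" .
  qed
  also have "\<dots> = 2 * \<kappa> * (real N)\<^sup>2 * (\<Sum>i\<in>{1..L}. ?k i * ?U i) +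
      \<kappa> / (real N)\<^sup>2 * (\<Sum>i\<in>{1..L}. real i powr (2 - \<beta> - 1))"
    by (simp add: sum.distrib sum_distrib_left)
  also have "\<dots> \<le> 2 * \<kappa> * (real N)\<^sup>2 * (exp (1 / 2) * E) + \<kappa> / (real N)\<^sup>2 * (real N powr (2 - \<beta>) / (2 - \<beta>))"
  proof (intro add_mono mult_left_mono)
    show "(\<Sum>i\<in>{1..L}. ?k i * ?U i) \<le> exp (1 / 2) * E"
      by (rule sum_chain_le[OF E c1])
    have "(\<Sum>i\<in>{1..L}. real i powr (2 - \<beta> - 1)) \<le> real L powr (2 - \<beta>) / (2 - \<beta>)"
      using \<beta> by (intro sum_powr_head_le) auto
    also have "\<dots> \<le> real N powr (2 - \<beta>) / (2 - \<beta>)"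
      using \<beta> N by (intro divide_right_mono powr_mono2) auto
    finally show "(\<Sum>i\<in>{1..L}. real i powr (2 - \<beta> - 1)) \<le> real N powr (2 - \<beta>) / (2 - \<beta>)" .
  qed (use \<kappa> in auto)
  also have "\<kappa> / (real N)\<^sup>2 * (real N powr (2 - \<beta>) / (2 - \<beta>)) = \<kappa> / (2 - \<beta>) * real N powr - \<beta>"
  proof -
    have "real N powr (2 - \<beta>) = (real N)\<^sup>2 * real N powr - \<beta>"
      using N powr_add[of "real N" 2 "- \<beta>"] by simp
    then show ?thesis using NN by simp
  qed
  finally show ?thesis by (simp add: mult_ac)
qed

text \<open>
  Below the cutoff the chain of unit steps is used, beyond it the antipodal terms with
  \<open>\<mu> = 1 / N\<^sup>2\<close>, which matches the energy factor of the chain. This tail estimate loses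
  \<open>\<delta> * (\<beta> - 1)\<close> in the exponent \<open>\<beta>\<close>; the choice \<open>\<delta> = 1 - \<beta> / 2\<close> keeps the loss below \<open>2 - \<beta>\<close>, as the
  theorem needs, while \<open>(k n) powr (1 - \<delta>)\<close> stays summable.

  The chain needs a lower bound on \<open>c 1\<close>. If \<open>w\<^sub>1 \<le> 1\<close>, then \<open>c 1\<close> or \<open>c (- 1)\<close> is at least \<open>- 1 / 2\<close>, and a
  reflection reduces the second case to the first. If \<open>w\<^sub>1 > 1\<close>, then the antipodal terms at distance
  \<open>1\<close> already force \<open>E \<ge> 1 / 64\<close>, and the antipodal estimate with cutoff \<open>1\<close> suffices, since its constant
  error is at most \<open>64 * E\<close>.
\<close>

lemma cutoff_bound_chain:
  assumes \<beta>: "1 < \<beta>" "\<beta> < 2"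
  shows "cutoff_bound \<beta> 2 (\<beta> - (1 - \<beta> / 2) * (\<beta> - 1))"
proof -
  define b where "b = \<beta> - (1 - \<beta> / 2) * (\<beta> - 1)"
  define \<delta> where "\<delta> = 1 - \<beta> / 2"
  define \<kappa> where "\<kappa> = 1 + 1 / \<beta>"
  have \<kappa>: "0 < \<kappa>" using \<beta> by (simp add: \<kappa>_def add_pos_pos)
  have \<delta>: "0 < \<delta>" "\<delta> \<le> 1" using \<beta> by (auto simp: \<delta>_def)
  define q where "q = (1 + \<beta>) * (1 - \<delta>)"
  have "1 * 1 < \<beta> * \<beta>" using \<beta> by (intro mult_strict_mono) auto
  then have q: "1 < q" using \<beta> by (simp add: q_def \<delta>_def algebra_simps)
  have exponent: "- 2 * \<delta> + (1 - q) = - b"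
    by (simp add: q_def b_def \<delta>_def field_simps)
  have b: "b \<le> \<beta>" using \<beta> by (simp add: b_def)
  obtain C0 where C0: "0 < C0"
    "\<forall>c E N M. energy_bound (power_kernel \<beta>) c E \<longrightarrow> c 0 = 0 \<longrightarrow> 1 \<le> N \<longrightarrow>
      antipodal_sum \<beta> c {1..M} \<le> C0 * (E * real N powr (1 + \<beta>) + real N powr - \<beta>)"
    using cutoff_bound_antipodal[of \<beta>] \<beta> unfolding cutoff_bound_def by auto
  obtain C1 where C1: "0 < C1"
    "\<forall>\<beta> c E \<mu> I. energy_bound (power_kernel \<beta>) c E \<longrightarrow> c 0 = 0 \<longrightarrow> 0 < \<mu> \<longrightarrow> finite I \<longrightarrow> I \<subseteq> {1..} \<longrightarrow>
      antipodal_sum \<beta> c I \<le>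
        C1 * (E / \<mu>) + \<mu> powr \<delta> * (\<Sum>n\<in>I. real n powr - ((1 + \<beta>) * (1 - \<delta>)))"
    using weighted_sum_le[OF \<delta>] by blast
  define C2 where "C2 = 2 * \<kappa> * exp (1 / 2) + C1"
  define C3 where "C3 = \<kappa> / (2 - \<beta>) + 1 / (q - 1)"
  have C2: "0 < C2" using C1 \<kappa> by (simp add: C2_def add_pos_pos)
  have C3: "0 < C3" using \<beta> \<kappa> q by (simp add: C3_def add_pos_pos)
  define C where "C = C2 + C3 + 65 * C0"
  have C: "0 < C" "C2 \<le> C" "C3 \<le> C" "65 * C0 \<le> C" using C0 C2 C3 by (auto simp: C_def)
  have main: "antipodal_sum \<beta> c {1..M} \<le>
      C2 * (E * real N powr 2) + C3 * real N powr - b"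
    if E: "energy_bound (power_kernel \<beta>) c E" and c0: "c 0 = 0" and N: "1 \<le> N"
      and c1: "- 1 / 2 \<le> c 1" for c E N M
  proof -
    let ?f = "\<lambda>n. real n powr - (1 + \<beta>) * neg_second_difference c n"
    define \<mu> where "\<mu> = real N powr - 2"
    have \<mu>: "0 < \<mu>" using N by (simp add: \<mu>_def)
    have E\<mu>: "E / \<mu> = E * real N powr 2"
      unfolding \<mu>_def powr_minus by (simp add: divide_inverse)
    have "(\<Sum>n\<in>{1..min N M}. ?f n) \<le> 2 * \<kappa> * exp (1 / 2) * (E * (real N)\<^sup>2) + \<kappa> / (2 - \<beta>) * real N powr - \<beta>"
      unfolding \<kappa>_def using N by (intro head_sum_le_chain[OF \<beta> E c0 c1]) auto
    also have "\<kappa> / (2 - \<beta>) * real N powr - \<beta> \<le> \<kappa> / (2 - \<beta>) * real N powr - b"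
      using \<kappa> \<beta> b N by (intro mult_left_mono powr_mono) auto
    finally have head: "(\<Sum>n\<in>{1..min N M}. ?f n) \<le>
        2 * \<kappa> * exp (1 / 2) * (E * real N powr 2) + \<kappa> / (2 - \<beta>) * real N powr - b"
      by simp
    have "(\<Sum>n\<in>{N<..M}. ?f n) \<le> C1 * (E / \<mu>) + \<mu> powr \<delta> * (\<Sum>n\<in>{N<..M}. real n powr - ((1 + \<beta>) * (1 - \<delta>)))"
      by (rule C1(2)[rule_format, OF E c0 \<mu>]) auto
    also have "\<mu> powr \<delta> * (\<Sum>n\<in>{N<..M}. real n powr - ((1 + \<beta>) * (1 - \<delta>))) \<le>
        \<mu> powr \<delta> * (real N powr (1 - q) / (q - 1))"
      unfolding q_def[symmetric] using N q by (intro mult_left_mono sum_powr_tail_le) auto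
    also have "\<dots> = 1 / (q - 1) * real N powr - b"
    proof -
      have "\<mu> powr \<delta> = real N powr (- 2 * \<delta>)" unfolding \<mu>_def powr_powr ..
      then show ?thesis unfolding exponent[symmetric] powr_add by simp
    qed
    finally have tail: "(\<Sum>n\<in>{N<..M}. ?f n) \<le> C1 * (E * real N powr 2) + 1 / (q - 1) * real N powr - b"
      by (simp only: E\<mu>)
    have "(\<Sum>n\<in>{1..M}. ?f n) \<le> (2 * \<kappa> * exp (1 / 2) * (E * real N powr 2) + \<kappa> / (2 - \<beta>) * real N powr - b)
        + (C1 * (E * real N powr 2) + 1 / (q - 1) * real N powr - b)"
      unfolding sum_split_at[of _ M N] by (intro add_mono head tail)
    also have "\<dots> = C2 * (E * real N powr 2) + C3 * real N powr - b"
      unfolding C2_def C3_def distrib_right by simp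
    finally show ?thesis .
  qed
  have "antipodal_sum \<beta> c {1..M} \<le>
      C * (E * real N powr 2 + real N powr - b)"
    if E: "energy_bound (power_kernel \<beta>) c E" and c0: "c 0 = 0" and N: "1 \<le> N" for c E N M
  proof -
    have E0: "0 \<le> E" by (rule energy_bound_nonneg[OF E])
    have N2: "1 \<le> real N powr 2" using N by simp
    have EN: "0 \<le> E * real N powr 2" using E0 by simp
    have "C2 * (E * real N powr 2) + C3 * real N powr - b \<le> C * (E * real N powr 2) + C * real N powr - b"
      using C EN by (intro add_mono mult_right_mono) auto
    then have small: ?thesis
      if "antipodal_sum \<beta> c {1..M} \<le>
        C2 * (E * real N powr 2) + C3 * real N powr - b"
      using that by (simp add: distrib_left)
    show ?thesis
    proof (cases "neg_second_difference c 1 \<le> 1")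
      case True
      then consider "- 1 / 2 \<le> c 1" | "- 1 / 2 \<le> c (- 1)"
        by (force simp: neg_second_difference_def)
      then show ?thesis
      proof cases
        case 1
        then show ?thesis using main[OF E c0 N] small by blast
      next
        case 2
        have "neg_second_difference (\<lambda>j. c (- j)) n = neg_second_difference c n" for n
          by (simp add: neg_second_difference_def)
        then show ?thesis
          using main[OF energy_bound_reflect[OF E power_kernel_uminus] _ N, of M] c0 2 small by simp
      qed
    next
      case False
      let ?w = "neg_second_difference c 1"
      have "1 * 1 \<le> ?w\<^sup>2 * exp (?w / 4)"
        using False by (intro mult_mono one_le_power) auto
      also have "\<dots> \<le> 64 * pair_cost ?w" using pair_cost_lower_bound[of ?w] False by simp
      also have "pair_cost ?w \<le> E" using antipodal_le[OF E c0, of 1] by simp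
      finally have E1: "1 \<le> 64 * E" by simp
      have "antipodal_sum \<beta> c {1..M} \<le> C0 * (E * real 1 powr (1 + \<beta>) + real 1 powr - \<beta>)"
        by (rule C0(2)[rule_format, OF E c0]) simp
      also have "\<dots> \<le> C0 * (65 * E)" using C0 E1 by (intro mult_left_mono) auto
      also have "\<dots> \<le> C * E" using C E0 by (simp add: mult_right_mono flip: mult.assoc)
      also have "\<dots> \<le> C * (E * real N powr 2 + real N powr - b)"
      proof (intro mult_left_mono)
        have "E * 1 \<le> E * real N powr 2" using E0 N2 by (intro mult_left_mono) auto
        then show "E \<le> E * real N powr 2 + real N powr - b"
          using powr_ge_zero[of "real N" "- b"] by linarith
      qed (use C in simp)
      finally show ?thesis .
    qed
  qed
  with C(1) show ?thesis unfolding cutoff_bound_def b_def[symmetric] by blast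
qed

section \<open>Lower bounds for the energy in terms of the generator\<close>

text \<open>
  The cutoff is chosen so that the term \<open>C * N powr - b\<close> is at most half of \<open>s\<close>.
\<close>

lemma optimise_cutoff:
  fixes a b C E s :: real
  assumes ab: "0 < a" "0 < b" and C: "0 < C" and s: "0 < s" "s \<le> 2 * C" and E: "0 \<le> E"
    and bound: "\<And>N::nat. 1 \<le> N \<Longrightarrow> s \<le> C * (E * real N powr a + real N powr - b)"
  shows "2 powr - a * (s / (2 * C)) powr (1 + a / b) \<le> E"
proof -
  define \<sigma> where "\<sigma> = s / (2 * C)"
  have \<sigma>: "0 < \<sigma>" "\<sigma> \<le> 1" using s C by (auto simp: \<sigma>_def)
  define r where "r = \<sigma> powr (- 1 / b)"
  have "1 powr (- 1 / b) \<le> r"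
    unfolding r_def using \<sigma> ab by (intro powr_mono2') auto
  then have r: "1 \<le> r" by simp
  define N where "N = nat \<lceil>r\<rceil>"
  have N: "r \<le> real N" "real N \<le> 2 * r"
    using r unfolding N_def by linarith+
  have N1: "1 \<le> N" using N(1) r by linarith
  have "real N powr - b \<le> r powr - b"
    using N r ab by (intro powr_mono2') auto
  also have "\<dots> = \<sigma>" using \<sigma> ab by (simp add: r_def powr_powr)
  finally have Nb: "real N powr - b \<le> \<sigma>" .
  have "real N powr a \<le> (2 * r) powr a"
    using N r ab by (intro powr_mono2) auto
  also have "\<dots> = 2 powr a * \<sigma> powr - (a / b)"
    using r ab \<sigma> by (simp add: powr_mult r_def powr_powr)
  finally have Na: "real N powr a \<le> 2 powr a * \<sigma> powr - (a / b)" .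
  have "2 * \<sigma> = s / C" using C by (simp add: \<sigma>_def)
  also have "\<dots> \<le> E * real N powr a + real N powr - b"
    using bound[OF N1] C by (simp add: divide_le_eq mult.commute)
  also have "\<dots> \<le> E * (2 powr a * \<sigma> powr - (a / b)) + \<sigma>"
    using E Na Nb by (intro add_mono mult_left_mono)
  finally have "\<sigma> \<le> E * (2 powr a * \<sigma> powr - (a / b))" by simp
  then have "\<sigma> * (2 powr - a * \<sigma> powr (a / b)) \<le>
      E * (2 powr a * \<sigma> powr - (a / b)) * (2 powr - a * \<sigma> powr (a / b))"
    by (rule mult_right_mono) simp
  also have "\<dots> = E * (2 powr a * 2 powr - a) * (\<sigma> powr - (a / b) * \<sigma> powr (a / b))"
    by simp
  also have "\<dots> = E"
    using \<sigma> by (simp del: mult_minus_left flip: powr_add)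
  finally show ?thesis
    unfolding \<sigma>_def[symmetric] powr_add using \<sigma> by (simp add: mult_ac)
qed

text \<open>
  Some \<open>n\<close> satisfies \<open>w\<^sub>n > (a * s / 2) * n powr (\<beta> / 2)\<close>: otherwise \<open>- L u x\<close> could be summed up to at
  most \<open>s / 2\<close>, since \<open>k n * n powr (\<beta> / 2)\<close> has total mass at most \<open>1 / a\<close>. For this \<open>n\<close> a single
  antipodal pair already costs an exponential in \<open>s * n powr (\<beta> / 2)\<close>, and the part of the exponent that
  depends on \<open>n\<close> makes up for the small weight \<open>(k n)\<^sup>2\<close>.

  The quantity \<open>s\<close> enters only as a number below every bound of the partial sums of \<open>- L u x\<close>.
\<close>

lemma energy_ge_exponential:
  assumes \<beta>: "0 < \<beta>"
  shows "\<exists>\<nu>>0. \<exists>S>0. \<exists>\<kappa>>0. \<forall>c E s. energy_bound (power_kernel \<beta>) c E \<longrightarrow> c 0 = 0 \<longrightarrow> S \<le> s \<longrightarrow>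
    (\<forall>R. (\<forall>M. antipodal_sum \<beta> c {1..M} \<le> R) \<longrightarrow> s \<le> R) \<longrightarrow> \<kappa> * exp (\<nu> * s) \<le> E"
proof -
  define a where "a = 1 / (1 + 2 / \<beta>)"
  have a: "0 < a" using \<beta> by (simp add: a_def add_pos_pos)
  \<comment> \<open>The power for which \<open>(n powr (\<beta> / 2)) powr r\<close> is the reciprocal of \<open>(k n)\<^sup>2\<close>.\<close>
  define r where "r = 4 * (1 + \<beta>) / \<beta>"
  have r: "0 < r" using \<beta> by (simp add: r_def)
  define K where "K = (8 * r) powr r"
  have K: "0 < K" using r by (simp add: K_def)
  have "1 / (64 * K) * exp (a / 16 * s) \<le> E"
    if E: "energy_bound (power_kernel \<beta>) c E" and c0: "c 0 = 0" and s: "2 / a \<le> s"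
      and lim: "\<forall>R. (\<forall>M. antipodal_sum \<beta> c {1..M} \<le> R) \<longrightarrow> s \<le> R"
    for c E s
  proof -
    have "0 < 2 / a" using a by simp
    then have s0: "0 < s" using s by linarith
    have as: "2 \<le> a * s" using s a by (simp add: field_simps)
    have "\<exists>n\<ge>1. a * s / 2 * real n powr (\<beta> / 2) < neg_second_difference c n"
    proof (rule ccontr)
      assume "\<not> ?thesis"
      then have le: "neg_second_difference c n \<le> a * s / 2 * real n powr (\<beta> / 2)" if "1 \<le> n" for n
        using that by force
      have "s \<le> s / 2"
      proof (rule lim[rule_format])
        fix M
        have "antipodal_sum \<beta> c {1..M} \<le>
            (\<Sum>n\<in>{1..M}. a * s / 2 * real n powr - (1 + \<beta> / 2))"
        proof (rule sum_mono)
          fix n assume n: "n \<in> {1..M}"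
          have "real n powr - (1 + \<beta>) * neg_second_difference c n \<le>
              real n powr - (1 + \<beta>) * (a * s / 2 * real n powr (\<beta> / 2))"
            using n by (intro mult_left_mono le) auto
          also have "\<dots> = a * s / 2 * real n powr - (1 + \<beta> / 2)"
          proof -
            have "- (1 + \<beta>) + \<beta> / 2 = - (1 + \<beta> / 2)" by simp
            then have "real n powr - (1 + \<beta>) * real n powr (\<beta> / 2) = real n powr - (1 + \<beta> / 2)"
              unfolding powr_add[symmetric] by (simp only:)
            then show ?thesis by (simp only: mult.left_commute)
          qed
          finally show "real n powr - (1 + \<beta>) * neg_second_difference c n \<le>
              a * s / 2 * real n powr - (1 + \<beta> / 2)" .
        qed
        also have "\<dots> = a * s / 2 * (\<Sum>n\<in>{1..M}. real n powr - (1 + \<beta> / 2))"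
          by (simp add: sum_distrib_left)
        also have "\<dots> \<le> a * s / 2 * ((1 + 1 / (\<beta> / 2)) * real 1 powr - (\<beta> / 2))"
          using \<beta> a s0 by (intro mult_left_mono sum_powr_from_le) auto
        also have "\<dots> = a * (1 + 2 / \<beta>) * (s / 2)" by simp
        also have "a * (1 + 2 / \<beta>) = 1" using a unfolding a_def by simp
        also have "1 * (s / 2) = s / 2" by simp
        finally show "antipodal_sum \<beta> c {1..M} \<le> s / 2" .
      qed
      then show False using s0 by simp
    qed
    then obtain n where n: "1 \<le> n" and w: "a * s / 2 * real n powr (\<beta> / 2) < neg_second_difference c n"
      by blast
    let ?w = "neg_second_difference c n"
    define J where "J = real n powr (\<beta> / 2)"
    have J: "1 \<le> J" using n \<beta> by (simp add: J_def ge_one_powr_ge_zero)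
    \<comment> \<open>One half of the product pays for \<open>s\<close>, the other one for \<open>J\<close>.\<close>
    have "a * s / 4 * 1 \<le> a * s / 4 * J" using J as by (intro mult_left_mono) auto
    moreover have "2 / 4 * J \<le> a * s / 4 * J" using J as by (intro mult_right_mono) auto
    moreover have "a * s / 2 * J = a * s / 4 * J + a * s / 4 * J" by simp
    ultimately have wge: "a * s / 4 + J / 2 \<le> ?w" using w unfolding J_def by linarith
    then have w1: "1 \<le> ?w" using as J by linarith
    have "J powr r / K \<le> exp (J / 8)"
    proof -
      have "(J / 2) powr r \<le> (4 * r) powr r * exp (J / 2 / 4)"
        using J r by (intro powr_le_exp_quarter) auto
      moreover have "(J / 2) powr r = J powr r / 2 powr r"
        using J by (simp add: powr_divide)
      moreover have "K = 2 powr r * (4 * r) powr r"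
        using r by (simp add: K_def flip: powr_mult)
      ultimately show ?thesis using K by (simp add: field_simps)
    qed
    also have "J powr r = real n powr (2 * (1 + \<beta>))"
    proof -
      have "\<beta> / 2 * r = 2 * (1 + \<beta>)" using \<beta> by (simp add: r_def)
      then show ?thesis unfolding J_def powr_powr by (simp only:)
    qed
    finally have "exp (a * s / 16) / 64 * (real n powr (2 * (1 + \<beta>)) / K) \<le> exp (a * s / 16) / 64 * exp (J / 8)"
      by (intro mult_left_mono) auto
    then have "1 / (64 * K) * exp (a / 16 * s) * real n powr (2 * (1 + \<beta>)) \<le> exp (a * s / 16) * exp (J / 8) / 64"
      by (simp add: mult_ac)
    also have "\<dots> \<le> exp (?w / 4) / 64"
      using wge by (simp flip: exp_add)
    also have "\<dots> \<le> ?w\<^sup>2 * exp (?w / 4) / 64"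
      using mult_right_mono[OF one_le_power[OF w1, of 2], of "exp (?w / 4)"] by simp
    also have "\<dots> \<le> pair_cost ?w"
      using w1 by (intro pair_cost_lower_bound) auto
    finally have "1 / (64 * K) * exp (a / 16 * s) * real n powr (2 * (1 + \<beta>)) *
        (real n powr - (1 + \<beta>))\<^sup>2 \<le> pair_cost ?w * (real n powr - (1 + \<beta>))\<^sup>2"
      by (rule mult_right_mono) simp
    also have "\<dots> \<le> E"
      using antipodal_le[OF E c0 n] by (simp add: mult.commute)
    also have "(real n powr - (1 + \<beta>))\<^sup>2 = real n powr - (2 * (1 + \<beta>))"
      unfolding power2_eq_square by (simp flip: powr_add)
    also have "1 / (64 * K) * exp (a / 16 * s) * real n powr (2 * (1 + \<beta>)) * real n powr - (2 * (1 + \<beta>))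
        = 1 / (64 * K) * exp (a / 16 * s)"
    proof -
      have "real n powr (2 * (1 + \<beta>)) * real n powr - (2 * (1 + \<beta>)) = 1"
        unfolding powr_add[symmetric] using n by simp
      then show ?thesis by (simp only: mult.assoc mult_1_right)
    qed
    finally show ?thesis .
  qed
  moreover have "0 < a / 16" "0 < 2 / a" "0 < 1 / (64 * K)" using a K by auto
  ultimately show ?thesis by blast
qed

text \<open>
  The sums over the symmetric intervals \<open>{- M..M}\<close> are cofinal among the finite sums, so a bound on all
  of them passes to the generator.
\<close>

lemma neg_gen_op_le_of_partial_sums:
  assumes \<beta>: "0 < \<beta>" and u: "bounded (range u)"
    and R: "\<And>M. antipodal_sum \<beta> (increment u x) {1..M} \<le> R"
  shows "- gen_op (power_kernel \<beta>) u x \<le> R"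
proof (rule ccontr)
  let ?c = "increment u x" and ?k = "power_kernel \<beta>"
  assume less: "\<not> ?thesis"
  obtain B where B: "\<And>y. \<bar>u y\<bar> \<le> B"
    using u by (auto simp: bounded_iff)
  have "\<bar>?c j\<bar> \<le> 2 * B" for j
    using B[of "x + j"] B[of x] unfolding increment_def by linarith
  then have "(\<lambda>j. ?k j * ?c j) summable_on UNIV"
    by (rule kernel_mult_bounded_summable[OF admissible_power_kernel[OF \<beta>]])
  then have "((\<lambda>j. ?k j * ?c j) has_sum gen_op ?k u x) UNIV"
    unfolding gen_op_def increment_def by simp
  then have "(sum (\<lambda>j. ?k j * ?c j) \<longlongrightarrow> gen_op ?k u x) (finite_subsets_at_top UNIV)"
    by (simp add: has_sum_def)
  then have "\<forall>\<^sub>F X in finite_subsets_at_top UNIV. sum (\<lambda>j. ?k j * ?c j) X < - R"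
    using less by (intro order_tendstoD(2)) auto
  then obtain X where X: "finite X" "\<And>Y. finite Y \<Longrightarrow> X \<subseteq> Y \<Longrightarrow> sum (\<lambda>j. ?k j * ?c j) Y < - R"
    unfolding eventually_finite_subsets_at_top by auto
  obtain M where M: "\<And>j. j \<in> X \<Longrightarrow> \<bar>j\<bar> \<le> int M"
  proof
    fix j assume "j \<in> X"
    then have "nat \<bar>j\<bar> \<le> Max (insert 0 ((\<lambda>j. nat \<bar>j\<bar>) ` X))"
      using X(1) by (intro Max_ge) auto
    then show "\<bar>j\<bar> \<le> int (Max (insert 0 ((\<lambda>j. nat \<bar>j\<bar>) ` X)))" by linarith
  qed
  have "sum (\<lambda>j. ?k j * ?c j) {- int M..int M} < - R"
    using M by (intro X(2)) (auto simp: abs_le_iff, force)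
  moreover have "sum (\<lambda>j. ?k j * ?c j) {- int M..int M} =
      - antipodal_sum \<beta> ?c {1..M}" for M
  proof (induction M)
    case 0
    show ?case by (simp add: power_kernel_def)
  next
    case (Suc M)
    have "{- int (Suc M)..int (Suc M)} = insert (int (Suc M)) (insert (- int (Suc M)) {- int M..int M})"
      by auto
    then have "sum (\<lambda>j. ?k j * ?c j) {- int (Suc M)..int (Suc M)} =
        ?k (int (Suc M)) * ?c (int (Suc M)) + (?k (- int (Suc M)) * ?c (- int (Suc M)) +
        sum (\<lambda>j. ?k j * ?c j) {- int M..int M})"
      by simp
    also have "\<dots> = - (\<Sum>n\<in>{1..Suc M}. real n powr - (1 + \<beta>) * neg_second_difference ?c n)"
      unfolding Suc power_kernel_uminus power_kernel_of_nat
      by (simp add: neg_second_difference_def algebra_simps)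
    finally show ?case .
  qed
  ultimately show False using R[of M] by simp
qed

text \<open>
  Enlarging \<open>C\<close> makes any prescribed range \<open>(0, X]\<close> admissible for the optimisation of the cutoff. On
  this range, normalised to \<open>(0, 1]\<close>, a larger exponent gives a weaker bound.
\<close>

lemma power_lower_bound_of_cutoff_bound:
  assumes \<beta>: "0 < \<beta>" and ab: "0 < a" "0 < b" and C: "0 < C"
    and bound: "\<forall>c E N M. energy_bound (power_kernel \<beta>) c E \<longrightarrow> c 0 = 0 \<longrightarrow> 1 \<le> N \<longrightarrow>
      antipodal_sum \<beta> c {1..M} \<le> C * (E * real N powr a + real N powr - b)"
    and p: "1 + a / b \<le> p" and X: "0 < X"
  shows "\<exists>\<kappa>>0. \<forall>u x. bounded (range u) \<longrightarrow> 0 < - gen_op (power_kernel \<beta>) u x \<longrightarrow> - gen_op (power_kernel \<beta>) u x \<le> X \<longrightarrow>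
      \<kappa> * (- gen_op (power_kernel \<beta>) u x / X) powr p \<le> Psi2_Upsilon (power_kernel \<beta>) u x"
proof -
  let ?k = "power_kernel \<beta>"
  define C' where "C' = max C X"
  have C': "0 < C'" "C \<le> C'" "X \<le> 2 * C'" using C X by (auto simp: C'_def)
  define \<kappa> where "\<kappa> = 2 powr - a * (X / (2 * C')) powr (1 + a / b) / 2"
  have \<kappa>: "0 < \<kappa>" using C' X by (simp add: \<kappa>_def)
  have "\<kappa> * (- gen_op ?k u x / X) powr p \<le> Psi2_Upsilon ?k u x"
    if u: "bounded (range u)" and s: "0 < - gen_op ?k u x" "- gen_op ?k u x \<le> X" for u x
  proof -
    let ?s = "- gen_op ?k u x" and ?E = "2 * Psi2_Upsilon ?k u x"
    have E: "energy_bound ?k (increment u x) ?E"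
      by (rule energy_bound_Psi2_Upsilon[OF admissible_power_kernel[OF \<beta>] u])
    have c0: "increment u x 0 = 0" by (simp add: increment_def)
    have "?s \<le> C' * (?E * real N powr a + real N powr - b)" if N: "1 \<le> N" for N
    proof -
      have "?s \<le> C * (?E * real N powr a + real N powr - b)"
        by (rule neg_gen_op_le_of_partial_sums[OF \<beta> u bound[rule_format, OF E c0 N]])
      also have "\<dots> \<le> C' * (?E * real N powr a + real N powr - b)"
        using C' energy_bound_nonneg[OF E] by (intro mult_right_mono add_nonneg_nonneg) auto
      finally show ?thesis .
    qed
    then have main: "2 powr - a * (?s / (2 * C')) powr (1 + a / b) \<le> ?E"
      using ab C' s energy_bound_nonneg[OF E] by (intro optimise_cutoff) auto
    have "(?s / X) powr p \<le> (?s / X) powr (1 + a / b)"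
    proof (rule powr_mono'[OF p])
      show "0 \<le> ?s / X" using s X by (intro divide_nonneg_pos) auto
      show "?s / X \<le> 1" using s X by (subst divide_le_eq_1_pos) auto
    qed
    then have "\<kappa> * (?s / X) powr p \<le> \<kappa> * (?s / X) powr (1 + a / b)"
      using \<kappa> by (intro mult_left_mono) auto
    also have "\<dots> = 2 powr - a * ((X / (2 * C')) * (?s / X)) powr (1 + a / b) / 2"
    proof -
      have "((X / (2 * C')) * (?s / X)) powr (1 + a / b) =
          (X / (2 * C')) powr (1 + a / b) * (?s / X) powr (1 + a / b)"
        by (rule powr_mult)
      then show ?thesis by (simp add: \<kappa>_def)
    qed
    also have "X / (2 * C') * (?s / X) = ?s / (2 * C')" using X by simp
    also have "2 powr - a * (?s / (2 * C')) powr (1 + a / b) / 2 \<le> Psi2_Upsilon ?k u x"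
      using main by simp
    finally show ?thesis .
  qed
  with \<kappa> show ?thesis by blast
qed

section \<open>The CD-function\<close>

text \<open>
  A power of \<open>r\<close> followed by an exponential, both equal to \<open>1\<close> at \<open>X\<close>. The quotient of the
  exponential by \<open>r\<close> increases from \<open>1 / \<nu>\<close> on, whence the condition \<open>1 \<le> \<nu> * X\<close> below.
\<close>

definition glue :: "real \<Rightarrow> real \<Rightarrow> real \<Rightarrow> real \<Rightarrow> real" where
  "glue p \<nu> X r = (if r \<le> X then (r / X) powr p else exp (\<nu> * (r - X)))"

lemma glue_nonneg: "0 \<le> glue p \<nu> X r"
  by (simp add: glue_def)

lemma continuous_on_glue:
  assumes "0 < p" "0 < X"
  shows "continuous_on {0..} (glue p \<nu> X)"
proof -
  have "continuous_on ({0..X} \<union> {X..}) (\<lambda>r. if r \<le> X then (r / X) powr p else exp (\<nu> * (r - X)))"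
    using assms
    by (intro continuous_on_If continuous_intros continuous_on_powr') auto
  moreover have "{0..X} \<union> {X..} = {0..}" using assms by auto
  ultimately show ?thesis by (simp add: glue_def[abs_def])
qed

lemma strict_mono_on_glue_ratio:
  assumes p: "1 < p" and X: "0 < X" and \<nu>: "0 < \<nu>" "1 \<le> \<nu> * X"
  shows "strict_mono_on {0<..} (\<lambda>r. glue p \<nu> X r / r)"
proof -
  have low: "glue p \<nu> X r / r < glue p \<nu> X t / t" if "0 < r" "r < t" "t \<le> X" for r t
  proof -
    have eq: "glue p \<nu> X z / z = (z / X) powr (p - 1) / X" if "0 < z" "z \<le> X" for z
    proof -
      have "(z / X) powr p = (z / X) powr (p - 1) * (z / X)"
        using that X powr_add[of "z / X" "p - 1" 1] by simp
      then show ?thesis using that X by (simp add: glue_def)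
    qed
    have "(r / X) powr (p - 1) < (t / X) powr (p - 1)"
      using that p X by (intro powr_less_mono2 divide_strict_right_mono) auto
    then show ?thesis using eq[of r] eq[of t] that X by (simp add: divide_strict_right_mono)
  qed
  have high: "glue p \<nu> X r / r < glue p \<nu> X t / t" if "X \<le> r" "r < t" for r t
  proof -
    have eq: "glue p \<nu> X z = exp (\<nu> * (z - X))" if "X \<le> z" for z
      using that X by (auto simp: glue_def)
    have r0: "0 < r" using that X by linarith
    define h where "h = \<nu> * (t - r)"
    have h: "0 < h" using that \<nu> by (simp add: h_def)
    have "1 \<le> \<nu> * r" using \<nu> that by (smt (verit) mult_left_mono)
    then have "t - r \<le> h * r"
      using that mult_right_mono[of 1 "\<nu> * r" "t - r"] by (simp add: h_def mult_ac)
    moreover have "1 + h + h\<^sup>2 / 2 \<le> exp h"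
      using h by (intro exp_lower_Taylor_quadratic) auto
    then have "1 + h < exp h" using h by (smt (verit) zero_less_power divide_pos_pos)
    then have "(1 + h) * r < exp h * r" using r0 by simp
    ultimately have "t < exp h * r" by (simp add: algebra_simps)
    then have "t * exp (\<nu> * (r - X)) < exp h * r * exp (\<nu> * (r - X))" by simp
    also have "\<dots> = exp (\<nu> * (t - X)) * r"
      by (simp add: h_def algebra_simps flip: exp_add)
    finally show ?thesis
      using that r0 by (simp add: eq divide_simps mult_ac)
  qed
  show ?thesis
  proof (rule strict_mono_onI)
    fix r t :: real
    assume "r \<in> {0<..}" "t \<in> {0<..}" "r < t"
    then consider "0 < r" "r < t" "t \<le> X" | "X \<le> r" "r < t" | "0 < r" "r < X" "X < t" by fastforce
    then show "glue p \<nu> X r / r < glue p \<nu> X t / t"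
    proof cases
      case 3
      then show ?thesis using low[of r X] high[of X t] by linarith
    qed (use low high in auto)
  qed
qed

lemma set_integrable_inverse_glue:
  assumes X: "0 < X" and \<nu>: "0 < \<nu>" and A: "0 < A"
  shows "set_integrable lborel {X..} (\<lambda>r. 1 / (A * glue p \<nu> X r))"
proof -
  have "(\<lambda>r. exp (- \<nu> * r)) absolutely_integrable_on {X..}"
    using \<nu> by (intro nonnegative_absolutely_integrable_1 integrable_on_exp_minus_to_infinity) auto
  then have "set_integrable lborel {X..} (\<lambda>r. exp (- \<nu> * r))"
    unfolding set_integrable_def by (subst (asm) integrable_completion) auto
  then have "set_integrable lborel {X..} (\<lambda>r. exp (\<nu> * X) / A * exp (- \<nu> * r))"
    by simp
  moreover have "exp (\<nu> * X) / A * exp (- \<nu> * r) = 1 / (A * glue p \<nu> X r)" if "r \<in> {X..}" for r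
  proof -
    have eq: "glue p \<nu> X r = exp (\<nu> * r) / exp (\<nu> * X)"
      using that X by (auto simp: glue_def algebra_simps exp_diff)
    show ?thesis unfolding eq using A by (simp add: exp_minus field_simps)
  qed
  ultimately show ?thesis
    by (subst set_integrable_cong[OF refl refl]) auto
qed

lemma CD_function_glue:
  assumes p: "1 < p" and X: "0 < X" and \<nu>: "0 < \<nu>" "1 \<le> \<nu> * X" and A: "0 < A"
  shows "CD_function (\<lambda>r. A * glue p \<nu> X r)"
  unfolding CD_function_def
proof (intro conjI)
  show "continuous_on {0..} (\<lambda>r. A * glue p \<nu> X r)"
    using p X by (intro continuous_on_mult_left continuous_on_glue) auto
  show "strict_mono_on {0<..} (\<lambda>r. A * glue p \<nu> X r / r)"
    using strict_mono_on_glue_ratio[OF p X \<nu>] A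
    by (simp add: strict_mono_on_def mult_strict_left_mono flip: times_divide_eq_right)
  show "\<exists>R>0. set_integrable lborel {R..} (\<lambda>r. 1 / (A * glue p \<nu> X r))"
    using set_integrable_inverse_glue[OF X \<nu>(1) A] X by blast
qed (use A X in \<open>auto simp: glue_nonneg glue_def\<close>)

text \<open>
  Scaling \<open>glue\<close> by a small factor \<open>A\<close> puts it below the power bound on \<open>[0, X]\<close> and below the
  exponential bound beyond \<open>X\<close>, while both asymptotic relations hold with equality near \<open>0\<close> and near
  infinity.
\<close>

lemma ex_CD_function:
  assumes \<beta>: "0 < \<beta>" and ab: "0 < a" "0 < b"
    and bound: "cutoff_bound \<beta> a b"
    and p: "1 + a / b \<le> p"
  shows "\<exists>c\<^sub>1>0. \<exists>c\<^sub>2>0. \<exists>\<nu>>0. \<exists>F.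
    CD_function F \<and> CD_Upsilon0 (power_kernel \<beta>) F \<and>
    F \<sim>[at_right 0] (\<lambda>x. c\<^sub>1 * x powr p) \<and> F \<sim>[at_top] (\<lambda>x. c\<^sub>2 * exp (\<nu> * x))"
proof -
  let ?k = "power_kernel \<beta>"
  have "0 < a / b" using ab by simp
  then have p1: "1 < p" using p by linarith
  obtain \<nu> S \<kappa> where \<nu>: "0 < \<nu>" and S: "0 < S" and \<kappa>: "0 < \<kappa>"
    and expo: "\<forall>c E s. energy_bound ?k c E \<longrightarrow> c 0 = 0 \<longrightarrow> S \<le> s \<longrightarrow>
      (\<forall>R. (\<forall>M. antipodal_sum \<beta> c {1..M} \<le> R) \<longrightarrow> s \<le> R) \<longrightarrow> \<kappa> * exp (\<nu> * s) \<le> E"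
    using energy_ge_exponential[OF \<beta>] by blast
  define X where "X = max S (1 / \<nu>)"
  have X: "0 < X" "S \<le> X" "1 \<le> \<nu> * X" using S \<nu> by (auto simp: X_def max_def field_simps)
  obtain C where C: "0 < C" "\<forall>c E N M. energy_bound ?k c E \<longrightarrow> c 0 = 0 \<longrightarrow> 1 \<le> N \<longrightarrow>
      antipodal_sum \<beta> c {1..M} \<le> C * (E * real N powr a + real N powr - b)"
    using bound unfolding cutoff_bound_def by blast
  obtain \<kappa>' where \<kappa>': "0 < \<kappa>'"
    and poly: "\<forall>u x. bounded (range u) \<longrightarrow> 0 < - gen_op ?k u x \<longrightarrow> - gen_op ?k u x \<le> X \<longrightarrow>
      \<kappa>' * (- gen_op ?k u x / X) powr p \<le> Psi2_Upsilon ?k u x"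
    using power_lower_bound_of_cutoff_bound[OF \<beta> ab C p X(1)] by blast
  define A where "A = min \<kappa>' (\<kappa> * exp (\<nu> * X) / 2)"
  have A: "0 < A" "A \<le> \<kappa>'" "A \<le> \<kappa> * exp (\<nu> * X) / 2" using \<kappa> \<kappa>' by (auto simp: A_def)
  define F where "F r = A * glue p \<nu> X r" for r
  have "CD_function F"
    unfolding F_def[abs_def] by (rule CD_function_glue[OF p1 X(1) \<nu> X(3) A(1)])
  moreover have "CD_Upsilon0 ?k F"
    unfolding CD_Upsilon0_def
  proof (intro allI impI)
    fix u :: "int \<Rightarrow> real" and x :: int
    assume u: "bounded (range u)"
    let ?s = "- gen_op ?k u x"
    have E: "energy_bound ?k (increment u x) (2 * Psi2_Upsilon ?k u x)"
      by (rule energy_bound_Psi2_Upsilon[OF admissible_power_kernel[OF \<beta>] u])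
    have nn: "0 \<le> Psi2_Upsilon ?k u x"
      using energy_bound_nonneg[OF E] by simp
    have "F ?s \<le> Psi2_Upsilon ?k u x" if s: "0 \<le> ?s"
    proof -
      consider "?s = 0" | "0 < ?s" "?s \<le> X" | "X < ?s" using s by linarith
      then show ?thesis
      proof cases
        case 1
        then show ?thesis using nn X by (simp add: F_def glue_def)
      next
        case 2
        then have "F ?s = A * (?s / X) powr p" by (simp add: F_def glue_def)
        also have "\<dots> \<le> \<kappa>' * (?s / X) powr p" using A by (intro mult_right_mono) auto
        also have "\<dots> \<le> Psi2_Upsilon ?k u x" by (rule poly[rule_format, OF u 2])
        finally show ?thesis .
      next
        case 3
        then have "F ?s = A * exp (\<nu> * (?s - X))" by (simp add: F_def glue_def)
        also have "\<dots> \<le> \<kappa> * exp (\<nu> * X) / 2 * exp (\<nu> * (?s - X))"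
          using A by (intro mult_right_mono) auto
        also have "\<dots> = \<kappa> * exp (\<nu> * ?s) / 2"
          by (simp add: algebra_simps flip: exp_add)
        also have "\<kappa> * exp (\<nu> * ?s) \<le> 2 * Psi2_Upsilon ?k u x"
          using 3 X by (intro expo[rule_format, OF E] neg_gen_op_le_of_partial_sums[OF \<beta> u]) (auto simp: increment_def)
        finally show ?thesis by simp
      qed
    qed
    then show "if - gen_op ?k u x \<ge> 0 then Psi2_Upsilon ?k u x \<ge> F (- gen_op ?k u x)
        else Psi2_Upsilon ?k u x \<ge> 0"
      using nn by simp
  qed
  moreover have "F \<sim>[at_right 0] (\<lambda>x. A / X powr p * x powr p)"
  proof (rule asymp_equiv_refl_ev)
    have "\<forall>\<^sub>F x in at_right 0. x \<in> {0<..<X}"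
      using X by (intro eventually_at_right_real) auto
    then show "\<forall>\<^sub>F x in at_right 0. F x = A / X powr p * x powr p"
      by eventually_elim (use X in \<open>auto simp: F_def glue_def powr_divide\<close>)
  qed
  moreover have "F \<sim>[at_top] (\<lambda>x. A * exp (- \<nu> * X) * exp (\<nu> * x))"
  proof (rule asymp_equiv_refl_ev)
    show "\<forall>\<^sub>F x in at_top. F x = A * exp (- \<nu> * X) * exp (\<nu> * x)"
      using eventually_gt_at_top[of X]
      by eventually_elim (auto simp: F_def glue_def algebra_simps simp flip: exp_add)
  qed
  moreover have "0 < A / X powr p" "0 < A * exp (- \<nu> * X)" using A X by auto
  ultimately show ?thesis using \<nu> by blast
qed

section \<open>The curvature-dimension condition for power-type kernels\<close>

text \<open>
  The antipodal estimate has \<open>a = 1 + \<beta>\<close> and \<open>b = \<beta>\<close>, hence the exponent \<open>(1 + 2 * \<beta>) / \<beta>\<close>. The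
  chain estimate has \<open>a = 2\<close> and \<open>b \<ge> 2 * (\<beta> - 1)\<close>, hence an exponent of at most
  \<open>1 + 1 / (\<beta> - 1)\<close>, which is smaller than \<open>1 + 1 / (\<beta> - \<epsilon> - 1) = (\<beta> - \<epsilon>) / (\<beta> - \<epsilon> - 1)\<close>.
\<close>

theorem theorem4p6:
  fixes \<beta> \<beta>\<^sub>s :: real
  assumes "\<beta> \<in> {0<..<2}"
  defines "\<beta>\<^sub>s \<equiv> (1 + sqrt 5) / 2"
  shows
    "(\<beta> \<in> {0<..\<beta>\<^sub>s} \<longrightarrow>
       (\<exists>c\<^sub>1>0. \<exists>c\<^sub>2>0. \<exists>\<nu>>0. \<exists>F.
          CD_function F \<and> CD_Upsilon0 (power_kernel \<beta>) F \<and>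
          F \<sim>[at_right 0] (\<lambda>x. c\<^sub>1 * x powr ((1 + 2 * \<beta>) / \<beta>)) \<and>
          F \<sim>[at_top] (\<lambda>x. c\<^sub>2 * exp (\<nu> * x))))
     \<and> (\<beta> \<in> {\<beta>\<^sub>s<..<2} \<longrightarrow>
       (\<forall>\<epsilon>\<in>{0<..<\<beta> - 1}. \<exists>c\<^sub>3>0. \<exists>c\<^sub>4>0. \<exists>\<nu>>0. \<exists>F.
          CD_function F \<and> CD_Upsilon0 (power_kernel \<beta>) F \<and>
          F \<sim>[at_right 0] (\<lambda>x. c\<^sub>3 * x powr ((\<beta> - \<epsilon>) / (\<beta> - \<epsilon> - 1))) \<and>
          F \<sim>[at_top] (\<lambda>x. c\<^sub>4 * exp (\<nu> * x))))"
proof (intro conjI impI ballI)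
  have \<beta>: "0 < \<beta>" "\<beta> < 2" using assms(1) by auto
  show "\<exists>c\<^sub>1>0. \<exists>c\<^sub>2>0. \<exists>\<nu>>0. \<exists>F.
      CD_function F \<and> CD_Upsilon0 (power_kernel \<beta>) F \<and>
      F \<sim>[at_right 0] (\<lambda>x. c\<^sub>1 * x powr ((1 + 2 * \<beta>) / \<beta>)) \<and>
      F \<sim>[at_top] (\<lambda>x. c\<^sub>2 * exp (\<nu> * x))"
    using \<beta> by (intro ex_CD_function[OF _ _ _ cutoff_bound_antipodal]) (auto simp: field_simps)
next
  fix \<epsilon>
  assume large: "\<beta> \<in> {\<beta>\<^sub>s<..<2}" and \<epsilon>: "\<epsilon> \<in> {0<..<\<beta> - 1}"
  have \<beta>: "1 < \<beta>" "\<beta> < 2" using \<epsilon> large by auto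
  define b where "b = \<beta> - (1 - \<beta> / 2) * (\<beta> - 1)"
  have "(1 - \<beta> / 2) * (\<beta> - 1) \<le> (1 - \<beta> / 2) * 1"
    using \<beta> by (intro mult_left_mono) auto
  then have "b \<ge> \<beta> - (1 - \<beta> / 2)" by (simp add: b_def)
  then have b: "2 * (\<beta> - 1) \<le> b" using \<beta> by argo
  then have b0: "0 < b" using \<beta> by argo
  have "2 / b \<le> 2 / (2 * (\<beta> - \<epsilon> - 1))"
    using b \<epsilon> by (intro divide_left_mono) auto
  moreover have "(\<beta> - \<epsilon>) / (\<beta> - \<epsilon> - 1) = 1 + 2 / (2 * (\<beta> - \<epsilon> - 1))"
    using \<epsilon> by (simp add: field_simps)
  ultimately have p: "1 + 2 / b \<le> (\<beta> - \<epsilon>) / (\<beta> - \<epsilon> - 1)" by argo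
  have "cutoff_bound \<beta> 2 b"
    unfolding b_def by (rule cutoff_bound_chain[OF \<beta>])
  then show "\<exists>c\<^sub>3>0. \<exists>c\<^sub>4>0. \<exists>\<nu>>0. \<exists>F.
      CD_function F \<and> CD_Upsilon0 (power_kernel \<beta>) F \<and>
      F \<sim>[at_right 0] (\<lambda>x. c\<^sub>3 * x powr ((\<beta> - \<epsilon>) / (\<beta> - \<epsilon> - 1))) \<and>
      F \<sim>[at_top] (\<lambda>x. c\<^sub>4 * exp (\<nu> * x))"
    using \<beta> b0 p by (intro ex_CD_function) auto
qed

end
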